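(* Let $T^l$ be a well-structured graph on the vertex set $[n]$ and let $T^l_1,\dots,T^l_m$ be all alternating well-structured spanning graphs of $\overline{T^l}$. Then $\mathcal{P}(T^l_1),\dots,\mathcal{P}(T^l_m)$ are $n$-dimensional simplices forming a triangulation of $\mathcal{P}(T^l)$. Furthermore, $$\operatorname{vol}_n(\mathcal{P}(T^l))=f_{T^l}\,\frac{2}{n!},$$ where $f_{T^l}$ is the number of alternating well-structured spanning graphs $G$ of $\overline{T^l}$.
   Context: A signed graph on $[n]=\{1,\dots,n\}$ is a finite multigraph (loops allowed) with each edge labeled $+$ or $-$; all loops are labeled $+$. An edge with endpoints $i,j$ and sign $\epsilon$ is written $(i,j,\epsilon)=(j,i,\epsilon)$. A positive edge is incident with a positive sign to both endpoints; a negative edge is incident with a positive sign to its smaller endpoint and with a negative sign to its larger one. A graph is alternating if at every vertex all incident edges are incident with the same sign. A graph $H$ on $[n]$ is well-structured if: (i) $H$ is noncrossing, i.e. there are no $i<j<k<l$ with edges $(i,k,\epsilon_1),(j,l,\epsilon_2)$ of $H$; (ii) for any edges $(i,j,+),(k,l,+)$ with $i<j$, $k<l$: $i<l$ and $k<j$; (iii) for any edges $(i,i,+),(k,l,+)$ with $k<l$: $k\le i\le l$; (iv) there are no edges $(i,i,+),(k,j,-)$ with $k<i<j$; (v) there are no edges $(i,j,+),(k,l,-)$ with $k\le i<j\le l$; (vi) $H$ is connected, contains exactly one loop, and contains no nonloop cycles. Let $e_1,\dots,e_n$ be the standard basis of $\mathbb{R}^n$. For $i\le j$ put $\mathrm{v}(i,j,-)=e_i-e_j$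 (here $i<j$) and $\mathrm{v}(i,j,+)=e_i+e_j$ (so $\mathrm{v}(i,i,+)=2e_i$). Let $\Phi^+=\{e_i-e_j,\ e_i+e_j,\ 2e_k : 1\le i<j\le n,\ k\in[n]\}$. The cone $\mathcal{C}(G)$ is the set of nonnegative linear combinations of the vectors $\mathrm{v}(e)$, $e\in E(G)$; $\mathcal{P}(G)=\operatorname{ConvHull}(\{0\}\cup(\Phi^+\cap\mathcal{C}(G)))$. $\overline{G}$ is the graph on $[n]$ whose edges are all $(i,j,\epsilon)$ with $\mathrm{v}(i,j,\epsilon)\in\Phi^+\cap\mathcal{C}(G)$. A spanning graph of $\overline{T^l}$ is a graph on $[n]$ all of whose edges are in $\overline{T^l}$. A (central) triangulation of a $d$-dimensional root polytope $\mathcal{P}(G)$ is a collection of $d$-dimensional simplices with pairwise disjoint interiors whose union is $\mathcal{P}(G)$, each having the origin as a vertex and all its other vertices in $\Phi^+\cap\mathcal{C}(G)$. $\operatorname{vol}_n$ is $n$-dimensional Euclidean volume. *)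

theory Defs
  imports "HOL-Analysis.Analysis" "HOL-Library.Multiset"
begin

section \<open>Signed graphs\<close>

text \<open>
  The vertex set \<open>[n]\<close> is a type \<open>'n\<close>, a finite linear order with \<open>n = CARD('n)\<close> elements. It also
  indexes the coordinates of \<open>real ^ 'n\<close>.

  An undirected edge is stored once, with its smaller endpoint first, so that \<open>(i, j, s)\<close> and
  \<open>(j, i, s)\<close> denote the same edge through one representative. A multigraph is the multiset of
  its edges.
\<close>

datatype sign = Pos | Neg

type_synonym 'n sedge = "'n \<times> 'n \<times> sign"
type_synonym 'n sgraph = "'n sedge multiset"

fun valid_edge :: "'n::linorder sedge \<Rightarrow> bool" where
  "valid_edge (i, j, s) \<longleftrightarrow> i \<le> j \<and> (i = j \<longrightarrow> s = Pos)"

definition signed_graph :: "'n::linorder sgraph \<Rightarrow> bool" where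
  "signed_graph G \<longleftrightarrow> (\<forall>e \<in># G. valid_edge e)"

fun incident :: "'n sedge \<Rightarrow> 'n \<Rightarrow> bool" where
  "incident (i, j, s) u \<longleftrightarrow> u = i \<or> u = j"

text \<open>The sign with which an edge is incident to its endpoint \<open>u\<close>.\<close>

fun incident_sign :: "'n sedge \<Rightarrow> 'n \<Rightarrow> sign" where
  "incident_sign (i, j, s) u = (if s = Neg \<and> u = j then Neg else Pos)"

definition alternating :: "'n sgraph \<Rightarrow> bool" where
  "alternating G \<longleftrightarrow>
     (\<forall>u. \<forall>e \<in># G. \<forall>e' \<in># G.
        incident e u \<and> incident e' u \<longrightarrow> incident_sign e u = incident_sign e' u)"

fun joins :: "'n sedge \<Rightarrow> 'n \<Rightarrow> 'n \<Rightarrow> bool" where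
  "joins (i, j, s) u w \<longleftrightarrow> (u = i \<and> w = j) \<or> (u = j \<and> w = i)"

fun is_loop :: "'n sedge \<Rightarrow> bool" where
  "is_loop (i, j, s) \<longleftrightarrow> i = j"

definition graph_connected :: "'n sgraph \<Rightarrow> bool" where
  "graph_connected G \<longleftrightarrow> (\<forall>u w. (\<lambda>a b. \<exists>e \<in># G. joins e a b)\<^sup>*\<^sup>* u w)"

text \<open>
  A nonloop cycle runs through \<open>k \<ge> 2\<close> distinct vertices. The condition \<open>mset es \<subseteq># G\<close> says that
  its edges are distinct as edges of the multigraph; for \<open>k = 2\<close> the cycle is a pair of parallel
  edges, of equal or of different signs.
\<close>

definition nonloop_cycle :: "'n sgraph \<Rightarrow> 'n list \<Rightarrow> 'n sedge list \<Rightarrow> bool" where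
  "nonloop_cycle G vs es \<longleftrightarrow>
     2 \<le> length vs \<and> distinct vs \<and> length es = length vs \<and> mset es \<subseteq># G \<and>
     (\<forall>t < length vs. joins (es ! t) (vs ! t) (vs ! (Suc t mod length vs)))"

definition noncrossing :: "'n::linorder sgraph \<Rightarrow> bool" where
  "noncrossing G \<longleftrightarrow>
     \<not> (\<exists>i j k l s t. i < j \<and> j < k \<and> k < l \<and> (i, k, s) \<in># G \<and> (j, l, t) \<in># G)"

definition well_structured :: "'n::linorder sgraph \<Rightarrow> bool" where
  "well_structured G \<longleftrightarrow>
     signed_graph G \<and>
     noncrossing G \<and>
     (\<forall>i j k l. (i, j, Pos) \<in># G \<and> (k, l, Pos) \<in># G \<and> i < j \<and> k < l \<longrightarrow> i < l \<and> k < j) \<and>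
     (\<forall>i k l. (i, i, Pos) \<in># G \<and> (k, l, Pos) \<in># G \<and> k < l \<longrightarrow> k \<le> i \<and> i \<le> l) \<and>
     \<not> (\<exists>i j k. (i, i, Pos) \<in># G \<and> (k, j, Neg) \<in># G \<and> k < i \<and> i < j) \<and>
     \<not> (\<exists>i j k l. (i, j, Pos) \<in># G \<and> (k, l, Neg) \<in># G \<and> k \<le> i \<and> i < j \<and> j \<le> l) \<and>
     graph_connected G \<and>
     size (filter_mset is_loop G) = 1 \<and>
     \<not> (\<exists>vs es. nonloop_cycle G vs es)"


section \<open>Root polytopes of type C\<close>

fun edge_vec :: "'n::finite sedge \<Rightarrow> real ^ ('n::finite)" where
  "edge_vec (i, j, Pos) = axis i 1 + axis j 1"
| "edge_vec (i, j, Neg) = axis i 1 - axis j 1"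

definition pos_roots :: "(real ^ ('n::{finite, linorder})) set" where
  "pos_roots = {axis i 1 - axis j 1 | i j. i < j} \<union> {axis i 1 + axis j 1 | i j. i < j}
     \<union> {2 *\<^sub>R axis k 1 | k. True}"

definition graph_cone :: "'n::finite sgraph \<Rightarrow> (real ^ ('n::finite)) set" where
  "graph_cone G = {\<Sum>e \<in> set_mset G. c e *\<^sub>R edge_vec e | c. \<forall>e. 0 \<le> c e}"

definition root_polytope :: "'n::{finite, linorder} sgraph \<Rightarrow> (real ^ ('n::{finite, linorder})) set" where
  "root_polytope G = convex hull ({0} \<union> (pos_roots \<inter> graph_cone G))"

text \<open>The graph \<open>G\<close> with an overline: all edges whose vector is a positive root in the cone of \<open>G\<close>.\<close>

definition graph_closure :: "'n::{finite, linorder} sgraph \<Rightarrow> 'n::{finite, linorder} sgraph" where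
  "graph_closure G = mset_set {e. valid_edge e \<and> edge_vec e \<in> pos_roots \<inter> graph_cone G}"

lemma finite_sedges: "finite (A :: 'n::finite sedge set)"
proof -
  have "s \<in> {Pos, Neg}" for s
    by (cases s) simp_all
  then have "finite (UNIV :: sign set)"
    by (intro finite_subset[of UNIV "{Pos, Neg}"] subsetI) simp_all
  then have "finite (UNIV :: 'n::finite sedge set)"
    by (intro finite_Prod_UNIV) simp_all
  then show ?thesis
    by (rule rev_finite_subset) simp
qed

lemma mem_graph_closure_iff:
  "e \<in># graph_closure G \<longleftrightarrow> valid_edge e \<and> edge_vec e \<in> pos_roots \<inter> graph_cone G"
  unfolding graph_closure_def by (simp add: finite_sedges)

definition spanning_graph :: "'n::linorder sgraph \<Rightarrow> 'n::linorder sgraph \<Rightarrow> bool" where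
  "spanning_graph H G \<longleftrightarrow> signed_graph H \<and> set_mset H \<subseteq> set_mset G"

definition alt_ws_spanning :: "'n::{finite, linorder} sgraph \<Rightarrow> 'n::{finite, linorder} sgraph set" where
  "alt_ws_spanning G = {H. spanning_graph H (graph_closure G) \<and> alternating H \<and> well_structured H}"

text \<open>
  Triangulations are indexed families, so that members with distinct indices have disjoint
  interiors. For \<open>d < n\<close> the interior of a \<open>d\<close>-dimensional simplex is its relative interior; for
  \<open>d = n\<close> this is the topological interior.
\<close>

definition central_triangulation ::
  "'n::{finite, linorder} sgraph \<Rightarrow> 'i set \<Rightarrow> ('i \<Rightarrow> (real ^ ('n::{finite, linorder})) set) \<Rightarrow> bool" where
  "central_triangulation G I S \<longleftrightarrow>
     (\<forall>i \<in> I. aff_dim (root_polytope G) simplex S i \<and>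
        0 extreme_point_of S i \<and>
        (\<forall>x. x extreme_point_of S i \<and> x \<noteq> 0 \<longrightarrow> x \<in> pos_roots \<inter> graph_cone G)) \<and>
     disjoint_family_on (\<lambda>i. rel_interior (S i)) I \<and>
     (\<Union>i \<in> I. S i) = root_polytope G"

end

theory Submission
  imports Defs
begin

text \<open>
  If \<open>(i, j, Neg)\<close> and an edge with positive sign at \<open>j\<close> meet at \<open>j\<close>, the sum of their vectors is again
  a root, and replacing one of the two edges by that root (for a loop at \<open>j\<close>: doing this twice)
  covers the cone of the graph. Choosing the outermost such pair at \<open>j\<close> keeps the graph
  well-structured, and the total height of the roots grows, so every point of the cone of \<open>T\<close> lies in the
  cone of an alternating well-structured spanning graph. In an alternating graph the coordinates of
  edges never cancel. Hence the coefficients of a point \<open>x\<close> add up to half of its \<open>l\<^sub>1\<close>-norm,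
  which passes from cones to polytopes, and the coefficients are determined by \<open>x\<close>: match the first negative
  coordinate with the closest positive one before it, and, if none is negative, the outermost two
  positive ones. So the simplices do not overlap. Halving the loop turns the \<open>n\<close> edge vectors into a
  basis of the integer lattice, so each simplex has volume \<open>2/n!\<close>.
\<close>

text \<open>Covering and disjointness are independent arguments. The reductions follow one point
  \<open>x\<close> at a time and only have to keep it in the cone; how the pieces of a reduction
  meet is never recorded. That two alternating well-structured graphs do not overlap is proved for
  all such graphs at once, whether or not a chain of reductions leads to them. This is why the
  volume counts every alternating well-structured spanning graph. The obstacle is condition (vi),
  which is awkward to carry through an exchange of edges while it speaks of cyclic lists. For a
  connected graph with one loop it amounts to having n - 1 nonloop edges, a count that an exchange
  visibly preserves. Both directions are dimension counts with the differences
  \<open>axis i 1 - axis j 1\<close>. Uniqueness of the coefficients, in contrast, is an induction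
  that deletes edges, so it is phrased with conditions that subgraphs inherit.\<close>

section \<open>Unimodular simplices\<close>

text \<open>The library computes volumes of linear images only for index types of class \<^class>\<open>wellorder\<close>.\<close>

typedef (overloaded) 'a wo_copy = "UNIV :: 'a set"
  by simp

instantiation wo_copy :: (linorder) linorder
begin

definition less_eq_wo_copy :: "'a wo_copy \<Rightarrow> 'a wo_copy \<Rightarrow> bool" where
  "less_eq_wo_copy x y \<longleftrightarrow> Rep_wo_copy x \<le> Rep_wo_copy y"

definition less_wo_copy :: "'a wo_copy \<Rightarrow> 'a wo_copy \<Rightarrow> bool" where
  "less_wo_copy x y \<longleftrightarrow> Rep_wo_copy x < Rep_wo_copy y"

instance
  by standard (auto simp: less_eq_wo_copy_def less_wo_copy_def Rep_wo_copy_inject less_le_not_le)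

end

lemma bij_Rep_wo_copy: "bij Rep_wo_copy"
  by (metis Abs_wo_copy_inverse Rep_wo_copy_inverse UNIV_I bij_betw_byWitness subset_UNIV)

instance wo_copy :: (finite) finite
proof
  have "finite (Rep_wo_copy -` (UNIV :: 'a set))"
    by (rule finite_vimageI) (use bij_Rep_wo_copy bij_is_inj in auto)
  then show "finite (UNIV :: 'a wo_copy set)"
    by simp
qed

instance wo_copy :: ("{finite, linorder}") wellorder
proof (rule wf_wellorderI)
  have "wf {(x :: 'a wo_copy, y). x < y}"
    by (auto simp: trancl_def tranclp_less intro!: finite_acyclic_wf acyclicI)
  then show "wf {(x :: 'a wo_copy, y). x < y}" .
  show "OFCLASS('a wo_copy, linorder_class)"
    by intro_classes
qed

lemma det_in_Ints:
  fixes A :: "real ^ 'n ^ 'n"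
  assumes "\<And>i j. A $ i $ j \<in> \<int>"
  shows "det A \<in> \<int>"
  unfolding det_def using assms by (intro Ints_sum Ints_mult Ints_prod Ints_of_int) auto

text \<open>Both determinants are integers and their product is 1, so each is a unit of the
  integers.\<close>

lemma abs_det_eq_1:
  fixes A B :: "real ^ 'n ^ 'n"
  assumes "\<And>i j. A $ i $ j \<in> \<int>" "\<And>i j. B $ i $ j \<in> \<int>" "A ** B = mat 1"
  shows "\<bar>det A\<bar> = 1"
proof -
  obtain a b :: int where ab: "det A = of_int a" "det B = of_int b"
    using det_in_Ints assms by (metis Ints_cases)
  have "det A * det B = 1"
    using assms(3) by (metis det_I det_mul)
  then have "a * b = 1"
    unfolding ab by (metis of_int_eq_1_iff of_int_mult)
  then have "\<bar>a\<bar> = 1"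
    by (auto simp: zmult_eq_1_iff)
  then show ?thesis
    unfolding ab by (metis of_int_1 of_int_abs)
qed

text \<open>The first three hypotheses say that the vectors \<open>w j\<close> form a basis of the
  integer lattice, so their matrix has determinant 1 or -1 and only the factors \<open>d\<close>
  contribute to the volume. These are kept separate because the vector of a loop is twice a lattice
  basis vector.\<close>

lemma measure_unimodular_simplex_wellorder:
  fixes w :: "'n::{finite, wellorder} \<Rightarrow> real ^ 'n::_"
  assumes w: "\<And>i j. w j $ i \<in> \<int>" and b: "\<And>u j. b u j \<in> \<int>"
    and axis: "\<And>u. (\<Sum>j\<in>UNIV. b u j *\<^sub>R w j) = axis u 1"
    and d: "\<And>j. d j \<noteq> 0"
  shows "measure lebesgue (convex hull (insert 0 (range (\<lambda>j. d j *\<^sub>R w j)))) =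
    \<bar>\<Prod>j\<in>UNIV. d j\<bar> / fact CARD('n)"
    and "independent (range (\<lambda>j. d j *\<^sub>R w j))"
    and "inj (\<lambda>j. d j *\<^sub>R w j)"
proof -
  define W :: "real ^ ('n::_) ^ ('n::_)" where "W = (\<chi> i j. w j $ i)"
  have "W ** (\<chi> j u. b u j) = mat 1"
  proof -
    have "(\<Sum>j\<in>UNIV. w j $ i * b u j) = axis u 1 $ i" for i u
      by (simp add: mult.commute flip: axis)
    then show ?thesis
      by (simp add: W_def matrix_matrix_mult_def mat_def vec_eq_iff axis_def eq_commute)
  qed
  then have detW: "\<bar>det W\<bar> = 1"
    by (intro abs_det_eq_1) (auto simp: W_def w b)
  define M :: "real ^ ('n::_) ^ ('n::_)" where "M = (\<chi> i j. (d j *\<^sub>R w j) $ i)"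
  have "transpose M = (\<chi> j. d j *s transpose W $ j)"
    by (simp add: M_def W_def transpose_def vec_eq_iff)
  then have "det M = (\<Prod>j\<in>UNIV. d j) * det W"
    using det_rows_mul[of d "\<lambda>j. transpose W $ j"] det_transpose[of M] det_transpose[of W] by simp
  then have detM: "\<bar>det M\<bar> = \<bar>\<Prod>j\<in>UNIV. d j\<bar>"
    by (simp add: abs_mult detW)
  then have M0: "det M \<noteq> 0"
    using d by auto
  have col: "column j M = d j *\<^sub>R w j" for j
    by (simp add: M_def column_def vec_eq_iff)
  have cols: "columns M = range (\<lambda>j. d j *\<^sub>R w j)"
    by (auto simp: columns_def col)
  show ind: "independent (range (\<lambda>j. d j *\<^sub>R w j))"
    using det_dependent_columns[of M] M0 unfolding cols dependent_vec_eq by blast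
  show inj: "inj (\<lambda>j. d j *\<^sub>R w j)"
  proof (rule injI)
    fix x y assume "d x *\<^sub>R w x = d y *\<^sub>R w y"
    then show "x = y"
      using det_identical_columns[of x y M] M0 by (auto simp: col)
  qed
  have z: "0 \<notin> range (\<lambda>j. d j *\<^sub>R w j)"
    using ind by (rule contrapos_nn) (rule dependent_zero)
  have card: "card (insert 0 (range (\<lambda>j. d j *\<^sub>R w j))) = Suc CARD('n)"
    using z inj by (simp add: card_image)
  have bij: "bij_betw (\<lambda>j. d j *\<^sub>R w j) UNIV (insert 0 (range (\<lambda>j. d j *\<^sub>R w j)) - {0})"
    using z inj by (simp add: bij_betw_def)
  have "(\<chi> i j. (d j *\<^sub>R w j) $ i - (0 :: real ^ ('n::_)) $ i) = M"
    by (simp add: M_def vec_eq_iff)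
  then have "measure lborel (convex hull (insert 0 (range (\<lambda>j. d j *\<^sub>R w j)))) =
      \<bar>det M\<bar> / fact CARD('n)"
    using content_simplex[OF _ card _ bij] by simp
  moreover have "compact (convex hull (insert 0 (range (\<lambda>j. d j *\<^sub>R w j))))"
    by (intro finite_imp_compact_convex_hull) simp
  ultimately show "measure lebesgue (convex hull (insert 0 (range (\<lambda>j. d j *\<^sub>R w j)))) =
    \<bar>\<Prod>j\<in>UNIV. d j\<bar> / fact CARD('n)"
    using detM by (simp add: borel_compact)
qed

lemma prod_Basis_inner_cart: "(\<Prod>b\<in>Basis. v \<bullet> b) = (\<Prod>i\<in>UNIV. v $ i)"
  for v :: "real ^ 'n"
proof -
  have "Basis = range (\<lambda>i :: 'n. axis i (1 :: real))"
    by (auto simp: Basis_vec_def)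
  then have "(\<Prod>b\<in>Basis. v \<bullet> b) = (\<Prod>b\<in>range (\<lambda>i :: 'n. axis i (1 :: real)). v \<bullet> b)"
    by simp
  also have "\<dots> = (\<Prod>i\<in>UNIV. v $ i)"
    by (subst prod.reindex) (auto simp: inj_on_def axis_eq_axis inner_axis)
  finally show ?thesis .
qed

text \<open>Lebesgue measure is determined by its values on boxes, and renaming coordinates turns a
  box into a box with the same side lengths in another order.\<close>

lemma content_reindex:
  fixes p :: "'n::finite \<Rightarrow> 'm::finite" and S :: "(real ^ 'n) set"
  assumes p: "bij p" and S: "S \<in> sets borel"
  defines "g \<equiv> \<lambda>x :: real ^ 'm. \<chi> i. x $ p i"
  shows "measure lborel (g -` S) = measure lborel S"
proof -
  have g[measurable]: "g \<in> borel \<rightarrow>\<^sub>M borel"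
    unfolding g_def by (intro borel_measurable_continuous_onI continuous_intros)
  have "lborel = distr lborel borel g"
  proof (rule lborel_eqI)
    fix l u :: "real ^ 'n"
    assume le: "\<And>b. b \<in> Basis \<Longrightarrow> l \<bullet> b \<le> u \<bullet> b"
    define h :: "real ^ 'n \<Rightarrow> real ^ 'm" where "h x = (\<chi> i. x $ inv p i)" for x
    have le_cart: "l $ i \<le> u $ i" for i
      using le[of "axis i 1"] by (auto simp: Basis_vec_def inner_axis)
    have all_p: "(\<forall>i. Q i) \<longleftrightarrow> (\<forall>j. Q (p j))" for Q
      using p by (auto simp: bij_def) (metis surjD)
    have inv_p[simp]: "inv p (p j) = j" for j
      using p by (simp add: bij_is_inj)
    have "g -` box l u = box (h l) (h u)"
      by (simp add: set_eq_iff g_def h_def mem_box_cart all_p)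
    then have "emeasure (distr lborel borel g) (box l u) = emeasure lborel (box (h l) (h u))"
      by (simp add: emeasure_distr)
    also have "\<dots> = ennreal (\<Prod>b\<in>Basis. (h u - h l) \<bullet> b)"
    proof (rule emeasure_lborel_box)
      fix b :: "real ^ 'm" assume "b \<in> Basis"
      then show "h l \<bullet> b \<le> h u \<bullet> b"
        using le_cart by (auto simp: Basis_vec_def h_def inner_axis)
    qed
    also have "(\<Prod>b\<in>Basis. (h u - h l) \<bullet> b) = (\<Prod>i\<in>UNIV. (h u - h l) $ i)"
      by (rule prod_Basis_inner_cart)
    also have "\<dots> = (\<Prod>i\<in>UNIV. (u - l) $ i)"
      unfolding h_def using p
      by (intro prod.reindex_bij_witness[of _ p "inv p"]) (simp_all add: bij_is_surj surj_f_inv_f)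
    also have "\<dots> = (\<Prod>b\<in>Basis. (u - l) \<bullet> b)"
      by (rule prod_Basis_inner_cart[symmetric])
    finally show "emeasure (distr lborel borel g) (box l u) = (\<Prod>b\<in>Basis. (u - l) \<bullet> b)" .
  qed simp
  then have "measure lborel S = measure (distr lborel borel g) S"
    by (rule arg_cong)
  also have "\<dots> = measure lborel (g -` S)"
    using S by (subst measure_distr) auto
  finally show ?thesis ..
qed

text \<open>Renaming coordinates along \<open>wo_copy\<close> is a linear bijection: it maps convex
  hulls to convex hulls, preserves independence, and preserves volume by
  \<open>content_reindex\<close>.\<close>

lemma unimodular_simplex:
  fixes w :: "'n::{finite, linorder} \<Rightarrow> real ^ 'n::_"
  assumes w: "\<And>i j. w j $ i \<in> \<int>" and b: "\<And>u j. b u j \<in> \<int>"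
    and axis: "\<And>u. (\<Sum>j\<in>UNIV. b u j *\<^sub>R w j) = axis u 1"
    and d: "\<And>j. d j \<noteq> 0"
  shows
      "measure lebesgue (convex hull (insert 0 (range (\<lambda>j. d j *\<^sub>R w j)))) =
        \<bar>\<Prod>j\<in>UNIV. d j\<bar> / fact CARD('n)"
    and "independent (range (\<lambda>j. d j *\<^sub>R w j))"
    and "inj (\<lambda>j. d j *\<^sub>R w j)"
proof -
  let ?R = "Rep_wo_copy :: 'n wo_copy \<Rightarrow> 'n" and ?A = "Abs_wo_copy :: 'n \<Rightarrow> 'n wo_copy"
  have RA[simp]: "?R (?A x) = x" "?A (?R y) = y" for x y
    by (simp_all add: Abs_wo_copy_inverse Rep_wo_copy_inverse)
  have bijA: "bij ?A"
    by (rule bij_betw_byWitness[of _ ?R]) auto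
  define g :: "real ^ ('n::_) wo_copy \<Rightarrow> real ^ ('n::_)" where "g = (\<lambda>x. \<chi> i. x $ ?A i)"
  define h :: "real ^ ('n::_) \<Rightarrow> real ^ ('n::_) wo_copy" where "h = (\<lambda>x. \<chi> i. x $ ?R i)"
  have gh[simp]: "g (h x) = x" "h (g y) = y" for x y
    by (simp_all add: g_def h_def)
  have lin: "linear g" "linear h"
    by (auto intro!: linearI simp: g_def h_def vec_eq_iff)
  define v where "v = (\<lambda>j. h (w (?R j)))"
  have sum_R: "(\<Sum>j\<in>UNIV. f (?R j)) = (\<Sum>j\<in>UNIV. f j)" for f :: "'n \<Rightarrow> real ^ ('n::_)"
    by (rule sum.reindex_bij_witness[of _ ?A ?R]) auto
  have prod_R: "(\<Prod>j\<in>UNIV. d (?R j)) = (\<Prod>j\<in>UNIV. d j)"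
    by (rule prod.reindex_bij_witness[of _ ?A ?R]) auto
  have a: "(\<Sum>j\<in>UNIV. b (?R u) (?R j) *\<^sub>R v j) = axis u 1" for u
  proof -
    have "(\<Sum>j\<in>UNIV. b (?R u) (?R j) *\<^sub>R v j) = h (\<Sum>j\<in>UNIV. b (?R u) (?R j) *\<^sub>R w (?R j))"
      by (simp add: v_def linear_sum[OF lin(2)] linear_cmul[OF lin(2)])
    also have "\<dots> = h (axis (?R u) 1)"
      using sum_R[of "\<lambda>j. b (?R u) j *\<^sub>R w j"] axis by simp
    also have "\<dots> = axis u 1"
      by (auto simp: h_def axis_def vec_eq_iff Rep_wo_copy_inject)
    finally show ?thesis .
  qed
  have v: "v j $ i \<in> \<int>" for i j
    by (simp add: v_def h_def w)
  note U = measure_unimodular_simplex_wellorder[of v "\<lambda>u j. b (?R u) (?R j)" "\<lambda>j. d (?R j)", OF v b a d]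
  have r: "range (\<lambda>j. d j *\<^sub>R w j) = g ` range (\<lambda>j. d (?R j) *\<^sub>R v j)"
  proof -
    have "g ` range (\<lambda>j. d (?R j) *\<^sub>R v j) = (\<lambda>j. d j *\<^sub>R w j) ` range ?R"
      by (simp add: image_image v_def linear_cmul[OF lin(1)])
    moreover have "surj ?R"
      by (metis RA(1) surjI)
    ultimately show ?thesis
      by simp
  qed
  have inj_g: "inj g"
    by (metis gh(2) injI)
  show "independent (range (\<lambda>j. d j *\<^sub>R w j))"
    unfolding r by (rule linear_independent_injective_image[OF lin(1) U(2)])
      (rule inj_on_subset[OF inj_g subset_UNIV])
  show "inj (\<lambda>j. d j *\<^sub>R w j)"
  proof (rule injI)
    fix x y assume "d x *\<^sub>R w x = d y *\<^sub>R w y"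
    then have "h (d x *\<^sub>R w x) = h (d y *\<^sub>R w y)"
      by (rule arg_cong)
    then have "d (?R (?A x)) *\<^sub>R v (?A x) = d (?R (?A y)) *\<^sub>R v (?A y)"
      by (simp add: v_def linear_cmul[OF lin(2)])
    then have "?A x = ?A y"
      by (rule injD[OF U(3)])
    then show "x = y"
      by (rule bij_is_inj[OF bijA, THEN injD])
  qed
  let ?C = "convex hull (insert 0 (range (\<lambda>j. d j *\<^sub>R w j)))"
  let ?D = "convex hull (insert 0 (range (\<lambda>j. d (?R j) *\<^sub>R v j)))"
  have C: "?C = g ` ?D"
    unfolding r by (subst convex_hull_linear_image[OF lin(1)]) (simp add: linear_0[OF lin(1)])
  have "g -` ?C = ?D"
    unfolding C using inj_g by (simp add: inj_vimage_image_eq)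
  moreover have "compact ?C" "compact ?D"
    by (intro finite_imp_compact_convex_hull; simp)+
  ultimately have "measure lebesgue ?C = measure lebesgue ?D"
    using content_reindex[OF bijA, of ?C] by (simp add: borel_compact g_def)
  also have "\<dots> = \<bar>\<Prod>j\<in>UNIV. d j\<bar> / fact CARD('n wo_copy)"
    using U(1) by (simp add: prod_R)
  also have "CARD('n wo_copy) = CARD('n)"
    by (metis bij_betw_same_card bijA)
  finally show "measure lebesgue ?C = \<bar>\<Prod>j\<in>UNIV. d j\<bar> / fact CARD('n)" .
qed

section \<open>Connected graphs with one loop\<close>

definition adj :: "'n sedge set \<Rightarrow> 'n \<Rightarrow> 'n \<Rightarrow> bool" where
  "adj E a b \<longleftrightarrow> (\<exists>e\<in>E. joins e a b)"

definition connected_edges :: "'n sedge set \<Rightarrow> bool" where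
  "connected_edges E \<longleftrightarrow> (\<forall>u w. (adj E)\<^sup>*\<^sup>* u w)"

definition nonloops :: "'n sedge set \<Rightarrow> 'n sedge set" where
  "nonloops E = {e \<in> E. \<not> is_loop e}"

text \<open>Condition (vi), with the absence of nonloop cycles expressed by the number of nonloop edges.\<close>

definition one_loop_tree :: "'n::finite sedge set \<Rightarrow> bool" where
  "one_loop_tree E \<longleftrightarrow>
     connected_edges E \<and> card (nonloops E) + 1 = CARD('n) \<and> (\<exists>!r. \<exists>s. (r, r, s) \<in> E)"

text \<open>The oriented incidence vector. The sign is ignored on purpose: linear relations among
  these vectors reflect the cycles of the underlying unsigned graph.\<close>

fun edge_diff :: "'n::finite sedge \<Rightarrow> real ^ 'n::_" where
  "edge_diff (i, j, s) = axis i 1 - axis j 1"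

lemma joins_sym: "joins e a b \<longleftrightarrow> joins e b a"
  by (cases e) auto

lemma adj_rtranclp_sym: "(adj E)\<^sup>*\<^sup>* a b \<Longrightarrow> (adj E)\<^sup>*\<^sup>* b a"
proof (induction rule: rtranclp_induct)
  case (step y z)
  then show ?case
    by (meson adj_def converse_rtranclp_into_rtranclp joins_sym)
qed simp

lemma connected_edges_transfer:
  assumes "connected_edges E" "\<And>e a b. e \<in> E \<Longrightarrow> joins e a b \<Longrightarrow> (adj E')\<^sup>*\<^sup>* a b"
  shows "connected_edges E'"
  unfolding connected_edges_def
proof (intro allI)
  fix u w
  have "(adj E)\<^sup>*\<^sup>* u w"
    using assms(1) by (simp add: connected_edges_def)
  then show "(adj E')\<^sup>*\<^sup>* u w"
  proof (induction rule: rtranclp_induct)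
    case (step y z)
    then show ?case
      using assms(2) by (meson adj_def rtranclp_trans)
  qed simp
qed

lemma connected_edges_remove:
  assumes "connected_edges E" "joins e a b" "(adj (E - {e}))\<^sup>*\<^sup>* a b"
  shows "connected_edges (E - {e})"
proof (rule connected_edges_transfer[OF assms(1)])
  fix f x y
  assume f: "f \<in> E" "joins f x y"
  show "(adj (E - {e}))\<^sup>*\<^sup>* x y"
  proof (cases "f = e")
    case True
    then have "x = a \<and> y = b \<or> x = b \<and> y = a"
      using f assms(2) by (cases e) auto
    then show ?thesis
      using assms(3) adj_rtranclp_sym by metis
  next
    case False
    then show ?thesis
      using f by (intro r_into_rtranclp) (auto simp: adj_def)
  qed
qed

text \<open>Starting from \<open>axis r 1\<close>, a walk reaches every \<open>axis u 1\<close> by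
  adding or subtracting edge differences. So one axis vector and the differences of the nonloop
  edges span the space, which bounds the dimension.\<close>

lemma connected_edges_card:
  fixes E :: "'n::finite sedge set"
  assumes "connected_edges E"
  shows "CARD('n) \<le> card (nonloops E) + 1"
proof -
  obtain r :: 'n where True by simp
  let ?V = "insert (axis r 1) (edge_diff ` nonloops E)"
  have fin: "finite (nonloops E)"
    by (rule finite_sedges)
  have "axis u (1::real) \<in> span ?V" for u
  proof -
    have "(adj E)\<^sup>*\<^sup>* r u"
      using assms by (simp add: connected_edges_def)
    then show ?thesis
    proof (induction rule: rtranclp_induct)
      case base
      show ?case by (simp add: span_base)
    next
      case (step y z)
      then obtain i j s where e: "(i, j, s) \<in> E" and yz: "y = i \<and> z = j \<or> y = j \<and> z = i"
        by (auto simp: adj_def)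
      show ?case
      proof (cases "i = j")
        case True
        then show ?thesis
          using step yz by auto
      next
        case False
        then have d: "axis i 1 - axis j 1 \<in> span ?V"
          using e by (intro span_base) (force simp: nonloops_def image_iff)
        from yz show ?thesis
        proof
          assume "y = i \<and> z = j"
          then show ?thesis
            using span_diff[OF step.IH d] by simp
        next
          assume "y = j \<and> z = i"
          then show ?thesis
            using span_add[OF step.IH d] by simp
        qed
      qed
    qed
  qed
  then have "Basis \<subseteq> span ?V"
    by (auto simp: Basis_vec_def)
  then have "span ?V = UNIV"
    by (metis span_Basis span_mono span_span top.extremum_uniqueI)
  then have "CARD('n) \<le> dim ?V"
    by (metis dim_UNIV dim_span DIM_cart DIM_real mult.right_neutral order_refl)
  also have "\<dots> \<le> card ?V"
    using fin by (intro dim_le_card') simp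
  also have "\<dots> \<le> card (edge_diff ` nonloops E) + 1"
    using fin by (simp add: card_insert_if)
  also have "\<dots> \<le> card (nonloops E) + 1"
    using fin by (simp add: card_image_le)
  finally show ?thesis .
qed

text \<open>A one-loop tree attains the lower bound of \<open>connected_edges_card\<close>; with one
  nonloop edge less, a connected graph would fall below it.\<close>

lemma one_loop_tree_bridge:
  assumes "one_loop_tree E" "e \<in> E" "\<not> is_loop e"
  shows "\<not> connected_edges (E - {e})"
proof
  assume "connected_edges (E - {e})"
  then have "card (nonloops E) \<le> card (nonloops (E - {e}))"
    using connected_edges_card assms(1) unfolding one_loop_tree_def by fastforce
  moreover have "nonloops (E - {e}) \<subset> nonloops E"
    using assms(2,3) by (auto simp: nonloops_def)
  then have "card (nonloops (E - {e})) < card (nonloops E)"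
    by (rule psubset_card_mono[OF finite_sedges])
  ultimately show False
    by simp
qed

text \<open>The edges \<open>f\<close> and \<open>g\<close> lead around \<open>e\<close>, so
  \<open>e\<close> would not be a bridge. In this form acyclicity enters the reductions.\<close>

lemma one_loop_tree_no_triangle:
  assumes "one_loop_tree E" "e \<in> E" "f \<in> E" "g \<in> E" "e \<noteq> f" "e \<noteq> g"
    and "joins e a b" "joins f a c" "joins g c b" "a \<noteq> b"
  shows False
proof -
  have "adj (E - {e}) a c" "adj (E - {e}) c b"
    using assms by (auto simp: adj_def)
  then have "(adj (E - {e}))\<^sup>*\<^sup>* a b"
    by (meson r_into_rtranclp rtranclp_trans)
  then have "connected_edges (E - {e})"
    using assms(1) by (intro connected_edges_remove[OF _ \<open>joins e a b\<close>]) (auto simp: one_loop_tree_def)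
  moreover have "\<not> is_loop e"
    using assms(7,10) by (cases e) auto
  ultimately show False
    using one_loop_tree_bridge assms(1,2) by blast
qed

section \<open>Nonloop cycles and bridges\<close>

lemma rtranclp_distinct_path:
  assumes "R\<^sup>*\<^sup>* u w"
  obtains vs where "vs \<noteq> []" "hd vs = u" "last vs = w" "distinct vs" "successively R vs"
proof -
  have "\<exists>vs. vs \<noteq> [] \<and> hd vs = u \<and> last vs = w \<and> distinct vs \<and> successively R vs"
    using assms
  proof (induction rule: rtranclp_induct)
    case base
    show ?case by (intro exI[of _ "[u]"]) simp
  next
    case (step y z)
    then obtain vs where vs: "vs \<noteq> []" "hd vs = u" "last vs = y" "distinct vs" "successively R vs"
      by blast
    show ?case
    proof (cases "z \<in> set vs")
      \<comment> \<open>When the walk returns to a vertex of the path, the closed part is cut off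
        and the path ends at the earlier visit.\<close>
      case True
      then obtain ys zs where "vs = ys @ z # zs"
        by (meson split_list)
      then show ?thesis
        using vs by (intro exI[of _ "ys @ [z]"]) (auto simp: successively_append_iff hd_append)
    next
      case False
      then show ?thesis
        using vs step by (intro exI[of _ "vs @ [z]"]) (auto simp: successively_append_iff)
    qed
  qed
  then show ?thesis
    using that by blast
qed

lemma mset_subseteq_if_distinct: "distinct xs \<Longrightarrow> set xs \<subseteq> set_mset G \<Longrightarrow> mset xs \<subseteq># G"
  unfolding subseteq_mset_def distinct_count_atmost_1 by (auto simp: Suc_le_eq)

text \<open>A path from \<open>b\<close> back to \<open>a\<close> that avoids \<open>e\<close> is
  closed up by \<open>e\<close>. A path of one edge gives a pair of parallel edges.\<close>

lemma nonloop_cycle_if_not_bridge: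
  assumes e: "e \<in># G" "joins e a b" "a \<noteq> b"
    and path: "(adj (set_mset G - {e}))\<^sup>*\<^sup>* b a"
  shows "\<exists>vs es. nonloop_cycle G vs es"
proof -
  obtain vs where vs: "vs \<noteq> []" "hd vs = b" "last vs = a" "distinct vs"
      "successively (adj (set_mset G - {e})) vs"
    using rtranclp_distinct_path[OF path] .
  define m where "m = length vs - 1"
  have m: "length vs = Suc m"
    using vs(1) by (simp add: m_def)
  have ends: "vs ! 0 = b" "vs ! m = a"
    using vs(1-3) by (simp_all add: hd_conv_nth last_conv_nth m_def)
  then have "m \<noteq> 0"
    using e(3) by metis
  define F where "F t = (SOME f. f \<in> set_mset G - {e} \<and> joins f (vs ! t) (vs ! Suc t))" for t
  have "\<exists>f. f \<in> set_mset G - {e} \<and> joins f (vs ! t) (vs ! Suc t)" if "t < m" for t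
    using vs(5) that m unfolding successively_conv_nth adj_def Bex_def by simp
  then have F: "F t \<in> set_mset G - {e}" "joins (F t) (vs ! t) (vs ! Suc t)" if "t < m" for t
    unfolding F_def using that someI_ex by (metis (mono_tags, lifting))+
  define es where "es = map F [0..<m] @ [e]"
  have "inj_on F {0..<m}"
  proof (rule inj_onI)
    fix s t assume st: "s \<in> {0..<m}" "t \<in> {0..<m}" "F s = F t"
    have "joins (F s) (vs ! s) (vs ! Suc s)" "joins (F s) (vs ! t) (vs ! Suc t)"
      using st F(2)[of s] F(2)[of t] by auto
    then have "vs ! s = vs ! t \<or> vs ! s = vs ! Suc t \<and> vs ! Suc s = vs ! t"
      by (cases "F s") auto
    \<comment> \<open>One edge used in two different steps would be traversed in opposite
      directions, which on distinct vertices needs \<open>s = Suc t\<close> and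
      \<open>t = Suc s\<close> at once.\<close>
    then have "s = t \<or> s = Suc t \<and> Suc s = t"
      using st vs(4) m by (auto simp: nth_eq_iff_index_eq)
    then show "s = t"
      by linarith
  qed
  then have "distinct es"
    unfolding es_def using F(1) by (force simp: distinct_map)
  moreover have "set es \<subseteq> set_mset G"
    unfolding es_def using F(1) e(1) by auto
  ultimately have "mset es \<subseteq># G"
    by (rule mset_subseteq_if_distinct)
  moreover have "joins (es ! t) (vs ! t) (vs ! (Suc t mod length vs))" if "t < length vs" for t
  proof (cases "t = m")
    case True
    then show ?thesis
      using m ends e(2) by (simp add: es_def nth_append)
  next
    case False
    then have "t < m"
      using that m by simp
    then show ?thesis
      using m F(2) by (simp add: es_def nth_append)
  qed
  ultimately have "nonloop_cycle G vs es"
    unfolding nonloop_cycle_def using \<open>m \<noteq> 0\<close> m vs(4) by (simp add: es_def)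
  then show ?thesis
    by blast
qed

lemma independent_if_dual:
  assumes "\<And>e. e \<in> N \<Longrightarrow> linear (\<phi> e)" "\<And>e. e \<in> N \<Longrightarrow> \<phi> e (d e) \<noteq> (0::real)"
    and "\<And>e f. e \<in> N \<Longrightarrow> f \<in> N \<Longrightarrow> e \<noteq> f \<Longrightarrow> \<phi> e (d f) = 0"
  shows "inj_on d N \<and> independent (d ` N)"
proof
  show inj: "inj_on d N"
    using assms(2,3) by (metis inj_onI)
  show "independent (d ` N)"
    unfolding dependent_def
  proof safe
    fix e assume e: "e \<in> N" "d e \<in> span (d ` N - {d e})"
    have "\<phi> e x = 0" if "x \<in> d ` N - {d e}" for x
      using that e assms(3) by auto
    then have "\<phi> e (d e) = 0"
      using linear_eq_0_on_span[OF assms(1)[OF e(1)] _ e(2)] by blast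
    then show False
      using assms(2) e(1) by blast
  qed
qed

text \<open>Deleting a bridge \<open>e\<close> separates the component \<open>C e\<close> of one end
  from the other end. The sum of the coordinates over \<open>C e\<close> is nonzero on the
  difference of \<open>e\<close> and vanishes on those of all other edges, whose ends lie on the
  same side. So the differences are independent.\<close>

lemma bridges_card:
  fixes E :: "'n::finite sedge set"
  assumes "\<And>i j s. (i, j, s) \<in> E \<Longrightarrow> i \<noteq> j \<Longrightarrow> \<not> (adj (E - {(i, j, s)}))\<^sup>*\<^sup>* i j"
  shows "card (nonloops E) + 1 \<le> CARD('n)"
proof -
  define C where "C e = {u. (adj (E - {e}))\<^sup>*\<^sup>* (fst e) u}" for e
  define \<phi> where "\<phi> e x = (\<Sum>u\<in>C e. x $ u)" for e and x :: "real ^ 'n"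
  have \<phi>_diff: "\<phi> e (edge_diff (k, l, s)) = of_bool (k \<in> C e) - of_bool (l \<in> C e)" for e k l s
    by (simp add: \<phi>_def sum_subtractf axis_def of_bool_def)
  have "inj_on edge_diff (nonloops E) \<and> independent (edge_diff ` nonloops E)"
  proof (rule independent_if_dual)
    fix e assume e: "e \<in> nonloops E"
    show "linear (\<phi> e)"
      by (rule linearI) (simp_all add: \<phi>_def sum.distrib sum_distrib_left)
    obtain i j s where [simp]: "e = (i, j, s)"
      by (cases e)
    have "i \<in> C e" "j \<notin> C e"
      using e assms[of i j s] by (auto simp: C_def nonloops_def)
    then show "\<phi> e (edge_diff e) \<noteq> 0"
      using \<phi>_diff[of e i j s] by simp
  next
    fix e f assume ef: "e \<in> nonloops E" "f \<in> nonloops E" "e \<noteq> f"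
    obtain k l s where [simp]: "f = (k, l, s)"
      by (cases f)
    have "adj (E - {e}) k l" "adj (E - {e}) l k"
      using ef by (force simp: adj_def nonloops_def)+
    then have "k \<in> C e \<longleftrightarrow> l \<in> C e"
      unfolding C_def by (auto intro: rtranclp.rtrancl_into_rtrancl)
    then show "\<phi> e (edge_diff f) = 0"
      using \<phi>_diff by simp
  qed
  then have "card (nonloops E) = card (edge_diff ` nonloops E)" "independent (edge_diff ` nonloops E)"
    by (auto simp: card_image)
  \<comment> \<open>All differences lie in the hyperplane of coordinate sum 0, of dimension n -
    1.\<close>
  moreover have "edge_diff ` nonloops E \<subseteq> {x. (\<chi> i. 1) \<bullet> x = 0}"
    by (auto simp: nonloops_def inner_diff_right inner_axis)
  ultimately have "card (nonloops E) \<le> dim {x :: real ^ 'n. (\<chi> i. 1) \<bullet> x = 0}"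
    using independent_card_le_dim by metis
  also have "(\<chi> i. 1) \<noteq> (0 :: real ^ 'n)"
    by (simp add: vec_eq_iff)
  then have "dim {x :: real ^ 'n. (\<chi> i. 1) \<bullet> x = 0} = CARD('n) - 1"
    by (simp add: dim_hyperplane)
  finally show ?thesis
    using zero_less_card_finite[where 'a = 'n] by linarith
qed

text \<open>The rest of the cycle connects the ends of its first edge, so that edge could be deleted
  without disconnecting the graph. The rest really avoids it, since \<open>mset_set E\<close>
  contains each edge at most once.\<close>

lemma one_loop_tree_no_cycle:
  assumes tree: "one_loop_tree E" and cyc: "nonloop_cycle (mset_set E) vs es"
  shows False
proof -
  define m where "m = length vs"
  have m: "2 \<le> m" "length es = m" "length vs = m" and vs: "distinct vs"
    and es: "mset es \<subseteq># mset_set E"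
    and joins: "\<And>t. t < m \<Longrightarrow> joins (es ! t) (vs ! t) (vs ! (Suc t mod m))"
    using cyc by (auto simp: nonloop_cycle_def m_def)
  have "count (mset es) x \<le> 1" for x
  proof -
    have "count (mset es) x \<le> count (mset_set E) x"
      by (rule mset_subset_eq_count[OF es])
    also have "\<dots> \<le> 1"
      by (cases "x \<in> E") (simp_all add: finite_sedges)
    finally show ?thesis .
  qed
  then have dist: "distinct es"
    unfolding distinct_count_atmost_1 by (auto simp: le_Suc_eq)
  have sub: "set es \<subseteq> E"
    using set_mset_mono[OF es] by (simp add: finite_sedges)
  let ?e = "es ! 0"
  have other: "es ! t \<in> E - {?e}" if "0 < t" "t < m" for t
    using that sub dist m by (auto simp: nth_eq_iff_index_eq)
  have path: "t < m \<Longrightarrow> 0 < t \<Longrightarrow> (adj (E - {?e}))\<^sup>*\<^sup>* (vs ! 1) (vs ! t)" for t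
  proof (induction t)
    case (Suc t)
    show ?case
    proof (cases "t = 0")
      case False
      then have "adj (E - {?e}) (vs ! t) (vs ! Suc t)"
        using other[of t] joins[of t] Suc.prems unfolding adj_def by auto
      then show ?thesis
        using Suc False by (auto intro: rtranclp.rtrancl_into_rtrancl)
    qed simp
  qed simp
  have "adj (E - {?e}) (vs ! (m - 1)) (vs ! 0)"
    using other[of "m - 1"] joins[of "m - 1"] m unfolding adj_def by auto
  then have "(adj (E - {?e}))\<^sup>*\<^sup>* (vs ! 1) (vs ! 0)"
    using path[of "m - 1"] m by (auto intro: rtranclp.rtrancl_into_rtrancl)
  moreover have e: "joins ?e (vs ! 0) (vs ! 1)"
    using joins[of 0] m by simp
  ultimately have "connected_edges (E - {?e})"
    using connected_edges_remove tree joins_sym unfolding one_loop_tree_def by metis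
  moreover have "vs ! 0 \<noteq> vs ! 1"
    using vs m by (simp add: nth_eq_iff_index_eq)
  then have "\<not> is_loop ?e"
    using e by (cases ?e) auto
  moreover have "?e \<in> E"
  proof -
    have "?e \<in> set es"
      using m by (intro nth_mem) linarith
    then show ?thesis
      using sub by blast
  qed
  ultimately show False
    using one_loop_tree_bridge tree by blast
qed

declare split_paired_All [simp del] split_paired_Ex [simp del]

section \<open>Lattice bases from one-loop trees\<close>

lemma edge_vec_nth:
  "edge_vec (i, j, s) $ u = of_bool (u = i) + (if s = Pos then 1 else -1) * of_bool (u = j)"
  by (cases s) (auto simp: axis_def)

lemma edge_vec_nth_eq_0_iff: "valid_edge e \<Longrightarrow> edge_vec e $ u = 0 \<longleftrightarrow> \<not> incident e u"
  by (cases e) (auto simp: edge_vec_nth)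

lemma edge_vec_loop: "edge_vec (i, i, Pos) = 2 *\<^sub>R axis i 1"
  by (simp add: scaleR_2)

text \<open>Let \<open>v\<close> be \<open>edge_vec\<close> with the loop vector halved. The lattice
  \<open>L\<close> generated by \<open>v\<close> contains \<open>axis r 1\<close> at the vertex
  \<open>r\<close> of the loop, and walking along edges carries this to every vertex. So
  \<open>v\<close> enumerates a basis of the integer lattice, and \<open>d\<close> undoes the
  halving.\<close>

lemma
  fixes E :: "'n::{finite, linorder} sedge set"
  assumes tree: "one_loop_tree E" and valid: "\<forall>e\<in>E. valid_edge e"
  shows card_one_loop_tree: "card E = CARD('n)"
    and measure_one_loop_tree: 
      "measure lebesgue (convex hull (insert 0 (edge_vec ` E))) = 2 / fact CARD('n)"
    and independent_one_loop_tree: "independent (edge_vec ` E)"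
    and inj_on_one_loop_tree: "inj_on edge_vec E"
proof -
  have loops_Pos: "s = Pos" if "(q, q, s) \<in> E" for q s
    using valid that by fastforce
  then obtain r where r: "(r, r, Pos) \<in> E" and "\<And>q s. (q, q, s) \<in> E \<Longrightarrow> q = r"
    using tree unfolding one_loop_tree_def by blast
  then have r_unique: "q = r \<and> s = Pos" if "(q, q, s) \<in> E" for q s
    using that loops_Pos by blast
  have loop_eq: "e = (r, r, Pos)" if "e \<in> E" "is_loop e" for e
    using that r_unique by (cases e) force
  have E_eq: "E = insert (r, r, Pos) (nonloops E)"
    unfolding nonloops_def using r loop_eq by blast
  have r_notin: "(r, r, Pos) \<notin> nonloops E"
    by (simp add: nonloops_def)
  have fin: "finite (nonloops E)"
    by (rule finite_sedges)
  show card: "card E = CARD('n)"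
    using tree unfolding one_loop_tree_def by (subst E_eq) (simp add: fin r_notin)
  define v :: "'n sedge \<Rightarrow> real ^ ('n::_)"
    where "v e = (if is_loop e then axis (fst e) 1 else edge_vec e)" for e
  define d :: "'n sedge \<Rightarrow> real" where "d e = (if is_loop e then 2 else 1)" for e
  have dv: "d e *\<^sub>R v e = edge_vec e" if "e \<in> E" for e
    using loop_eq[OF that] by (cases "is_loop e") (auto simp: v_def d_def edge_vec_loop simp del: edge_vec.simps)
  define L where "L = {\<Sum>e\<in>E. c e *\<^sub>R v e | c. \<forall>e. c e \<in> \<int>}"
  have LI: "(\<Sum>e\<in>E. c e *\<^sub>R v e) \<in> L" if "\<And>e. c e \<in> \<int>" for c
    using that by (auto simp: L_def)
  have L_add: "x + y \<in> L" and L_diff: "x - y \<in> L" if xy: "x \<in> L" "y \<in> L" for x y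
  proof -
    obtain b c where bc: "\<forall>e. b e \<in> \<int>" "\<forall>e. c e \<in> \<int>" 
      "x = (\<Sum>e\<in>E. b e *\<^sub>R v e)" "y = (\<Sum>e\<in>E. c e *\<^sub>R v e)"
      using xy unfolding L_def by blast
    show "x + y \<in> L"
      using LI[of "\<lambda>e. b e + c e"] bc by (simp add: scaleR_add_left sum.distrib)
    show "x - y \<in> L"
      using LI[of "\<lambda>e. b e - c e"] bc by (simp add: scaleR_diff_left sum_subtractf)
  qed
  have L_base: "v e \<in> L" if "e \<in> E" for e
  proof -
    have "(\<Sum>f\<in>E. of_bool (f = e) *\<^sub>R v f) = (\<Sum>f\<in>E. if f = e then v f else 0)"
      by (rule sum.cong) auto
    also have "\<dots> = v e"
      using that by (simp add: finite_sedges)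
    finally show ?thesis
      using LI[of "\<lambda>f. of_bool (f = e)"] by simp
  qed
  have L_axis: "axis u 1 \<in> L" for u
  proof -
    have "(adj E)\<^sup>*\<^sup>* r u"
      using tree by (simp add: one_loop_tree_def connected_edges_def)
    then show ?thesis
    proof (induction rule: rtranclp_induct)
      case base
      show ?case
        using L_base[OF r] by (simp add: v_def)
    next
      case (step y z)
      then obtain i j s where e: "(i, j, s) \<in> E" and yz: "y = i \<and> z = j \<or> y = j \<and> z = i"
        by (auto simp: adj_def)
      show ?case
      proof (cases "i = j")
        case True
        then show ?thesis
          using step yz by auto
      next
        case False
        then have d: "edge_vec (i, j, s) \<in> L"
          using L_base[OF e] by (simp add: v_def)
        \<comment> \<open>For a negative edge the axis vectors of its ends differ by the edge
          vector, for a positive edge they add up to it. Either way the edge and one of them give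
          the other.\<close>
        from yz show ?thesis
        proof
          assume "y = i \<and> z = j"
          then show ?thesis
            using d L_diff[OF step.IH d] L_diff[OF d step.IH] by (cases s) auto
        next
          assume "y = j \<and> z = i"
          then show ?thesis
            using d L_add[OF d step.IH] L_diff[OF d step.IH] by (cases s) auto
        qed
      qed
    qed
  qed
  then obtain b where b: "\<And>u e. b u e \<in> \<int>" "\<And>u. (\<Sum>e\<in>E. b u e *\<^sub>R v e) = axis u 1"
    unfolding L_def by simp metis
  obtain h where h: "bij_betw h (UNIV :: 'n set) E"
    using card finite_same_card_bij[of "UNIV :: 'n set" E] finite_sedges[of E] by auto
  then have hE: "range h = E" and hmem: "h j \<in> E" for j
    by (auto simp: bij_betw_def)
  have vint: "v e $ i \<in> \<int>" for e i
    by (cases e) (auto simp: v_def edge_vec_nth axis_def)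
  have dh: "(\<lambda>j. d (h j) *\<^sub>R v (h j)) = edge_vec \<circ> h"
    using dv hmem by auto
  have "d (h j) \<noteq> 0" for j
    by (simp add: d_def)
  moreover have "(\<Sum>j\<in>UNIV. b u (h j) *\<^sub>R v (h j)) = axis u 1" for u
    using sum.reindex_bij_betw[OF h, of "\<lambda>e. b u e *\<^sub>R v e"] b(2) by simp
  ultimately have U: "measure lebesgue (convex hull (insert 0 (range (\<lambda>j. d (h j) *\<^sub>R v (h j))))) =
        \<bar>\<Prod>j\<in>UNIV. d (h j)\<bar> / fact CARD('n)"
      "independent (range (\<lambda>j. d (h j) *\<^sub>R v (h j)))" "inj (\<lambda>j. d (h j) *\<^sub>R v (h j))"
    using unimodular_simplex[of "\<lambda>j. v (h j)" "\<lambda>u j. b u (h j)" "\<lambda>j. d (h j)"] vint b(1) by blast+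
  have r: "range (edge_vec \<circ> h) = edge_vec ` E"
    unfolding hE[symmetric] by (rule image_comp[symmetric])
  show "independent (edge_vec ` E)"
    using U(2) unfolding dh r .
  show "inj_on edge_vec E"
    using U(3) unfolding dh hE[symmetric] by (rule inj_on_imageI)
  have "(\<Prod>j\<in>UNIV. d (h j)) = (\<Prod>e\<in>E. d e)"
    by (rule prod.reindex_bij_betw[OF h])
  \<comment> \<open>Only the loop contributes a factor other than 1.\<close>
  also have "\<dots> = 2"
    by (subst E_eq) (simp add: fin r_notin, simp add: d_def nonloops_def)
  finally show "measure lebesgue (convex hull (insert 0 (edge_vec ` E))) = 2 / fact CARD('n)"
    using U(1) unfolding dh r by simp
qed

section \<open>Well-structured graphs as edge sets\<close>

text \<open>Conditions (i) to (v) as a relation between two edges, so that inserting an edge is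
  checked against one old edge at a time. The symmetric half of a condition, such as
  \<open>k < j\<close> in (ii), comes from exchanging the two edges.\<close>

fun compatible :: "'n::linorder sedge \<Rightarrow> 'n sedge \<Rightarrow> bool" where
  "compatible (i, j, s) (k, l, t) \<longleftrightarrow>
     \<not> (i < k \<and> k < j \<and> j < l) \<and>
     (s = Pos \<and> t = Pos \<and> i < j \<and> k < l \<longrightarrow> i < l) \<and>
     (s = Pos \<and> t = Pos \<and> i = j \<and> k < l \<longrightarrow> k \<le> i \<and> i \<le> l) \<and>
     (s = Pos \<and> t = Neg \<and> i = j \<longrightarrow> \<not> (k < i \<and> i < l)) \<and>
     (s = Pos \<and> t = Neg \<and> i < j \<longrightarrow> \<not> (k \<le> i \<and> j \<le> l))"

definition admissible :: "'n::linorder sedge set \<Rightarrow> bool" where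
  "admissible E \<longleftrightarrow> (\<forall>e\<in>E. valid_edge e) \<and> (\<forall>e\<in>E. \<forall>f\<in>E. compatible e f)"

lemma admissible_subset: "admissible E \<Longrightarrow> F \<subseteq> E \<Longrightarrow> admissible F"
  unfolding admissible_def by blast

lemma admissible_insert:
  assumes "admissible E" "valid_edge e" "compatible e e"
    and "\<And>k l t. (k, l, t) \<in> E \<Longrightarrow> compatible e (k, l, t) \<and> compatible (k, l, t) e"
  shows "admissible (insert e E)"
proof -
  have "compatible e f \<and> compatible f e" if "f \<in> E" for f
    using assms(4)[of "fst f" "fst (snd f)" "snd (snd f)"] that by simp
  then show ?thesis
    using assms(1-3) unfolding admissible_def by blast
qed

lemma admissible_valid: "admissible E \<Longrightarrow> e \<in> E \<Longrightarrow> valid_edge e"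
  unfolding admissible_def by blast

lemma admissible_compatible: "admissible E \<Longrightarrow> e \<in> E \<Longrightarrow> f \<in> E \<Longrightarrow> compatible e f"
  unfolding admissible_def by blast

lemma admissible_noncrossing:
  "admissible E \<Longrightarrow> (i, k, s) \<in> E \<Longrightarrow> (j, l, t) \<in> E \<Longrightarrow> i < j \<Longrightarrow> j < k \<Longrightarrow> k < l \<Longrightarrow> False"
  using admissible_compatible by fastforce

lemma admissible_pos_pos:
  "admissible E \<Longrightarrow> (i, j, Pos) \<in> E \<Longrightarrow> (k, l, Pos) \<in> E \<Longrightarrow> i < j \<Longrightarrow> k < l \<Longrightarrow> i < l"
  using admissible_compatible by fastforce

lemma admissible_loop_pos:
  "admissible E \<Longrightarrow> (i, i, Pos) \<in> E \<Longrightarrow> (k, l, Pos) \<in> E \<Longrightarrow> k < l \<Longrightarrow> k \<le> i \<and> i \<le> l"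
  using admissible_compatible by fastforce

lemma admissible_loop_neg:
  "admissible E \<Longrightarrow> (i, i, Pos) \<in> E \<Longrightarrow> (k, j, Neg) \<in> E \<Longrightarrow> k < i \<Longrightarrow> i < j \<Longrightarrow> False"
  using admissible_compatible by fastforce

lemma admissible_pos_neg:
  "admissible E \<Longrightarrow> (i, j, Pos) \<in> E \<Longrightarrow> (k, l, Neg) \<in> E \<Longrightarrow> k \<le> i \<Longrightarrow> i < j \<Longrightarrow> j \<le> l \<Longrightarrow> False"
  using admissible_compatible by fastforce

lemma admissible_iff:
  "admissible E \<longleftrightarrow>
     (\<forall>e\<in>E. valid_edge e) \<and>
     \<not> (\<exists>i j k l s t. i < j \<and> j < k \<and> k < l \<and> (i, k, s) \<in> E \<and> (j, l, t) \<in> E) \<and>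
     (\<forall>i j k l. (i, j, Pos) \<in> E \<and> (k, l, Pos) \<in> E \<and> i < j \<and> k < l \<longrightarrow> i < l \<and> k < j) \<and>
     (\<forall>i k l. (i, i, Pos) \<in> E \<and> (k, l, Pos) \<in> E \<and> k < l \<longrightarrow> k \<le> i \<and> i \<le> l) \<and>
     \<not> (\<exists>i j k. (i, i, Pos) \<in> E \<and> (k, j, Neg) \<in> E \<and> k < i \<and> i < j) \<and>
     \<not> (\<exists>i j k l. (i, j, Pos) \<in> E \<and> (k, l, Neg) \<in> E \<and> k \<le> i \<and> i < j \<and> j \<le> l)"
    (is "_ \<longleftrightarrow> ?valid \<and> ?nc \<and> ?pp \<and> ?lp \<and> ?ln \<and> ?pn")
proof
  assume E: "admissible E"
  have ?valid
    using admissible_valid[OF E] by blast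
  moreover have ?nc
    using admissible_noncrossing[OF E] by blast
  moreover have ?pp
    using admissible_pos_pos[OF E] by blast
  moreover have ?lp
    using admissible_loop_pos[OF E] by blast
  moreover have ?ln
    using admissible_loop_neg[OF E] by blast
  moreover have ?pn
    using admissible_pos_neg[OF E] by blast
  ultimately show "?valid \<and> ?nc \<and> ?pp \<and> ?lp \<and> ?ln \<and> ?pn"
    by (intro conjI)
next
  assume E: "?valid \<and> ?nc \<and> ?pp \<and> ?lp \<and> ?ln \<and> ?pn"
  have "compatible (i, j, s) (k, l, t)" if e: "(i, j, s) \<in> E" "(k, l, t) \<in> E" for i j s k l t
    unfolding compatible.simps
  proof (intro conjI)
    have ?nc
      using E by (elim conjE)
    then show "\<not> (i < k \<and> k < j \<and> j < l)"
      using e by blast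
    have ?pp
      using E by (elim conjE)
    then show "s = Pos \<and> t = Pos \<and> i < j \<and> k < l \<longrightarrow> i < l"
      using e by blast
    have ?lp
      using E by (elim conjE)
    then show "s = Pos \<and> t = Pos \<and> i = j \<and> k < l \<longrightarrow> k \<le> i \<and> i \<le> l"
      using e by blast
    have ?ln
      using E by (elim conjE)
    then show "s = Pos \<and> t = Neg \<and> i = j \<longrightarrow> \<not> (k < i \<and> i < l)"
      using e by blast
    have ?pn
      using E by (elim conjE)
    then show "s = Pos \<and> t = Neg \<and> i < j \<longrightarrow> \<not> (k \<le> i \<and> j \<le> l)"
      using e by blast
  qed
  then have "compatible e f" if "e \<in> E" "f \<in> E" for e f
    using that by (metis prod_cases3)
  moreover have ?valid
    using E by (elim conjE)
  ultimately show "admissible E"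
    unfolding admissible_def by blast
qed

lemma connected_edges_set_mset: "connected_edges (set_mset G) \<longleftrightarrow> graph_connected G"
proof -
  have "adj (set_mset G) = (\<lambda>a b. \<exists>e\<in>#G. joins e a b)"
    by (intro ext) (simp add: adj_def)
  then show ?thesis
    by (simp add: connected_edges_def graph_connected_def)
qed

text \<open>A second copy of a nonloop edge is a cycle of length two and a second copy of the loop
  is a second loop, so (vi) forces a simple graph. For connected graphs the bounds
  \<open>connected_edges_card\<close> and \<open>bridges_card\<close> then turn acyclicity into the
  count n - 1.\<close>

lemma well_structured_iff:
  fixes G :: "'n::{finite, linorder} sgraph"
  shows "well_structured G \<longleftrightarrow>
    G = mset_set (set_mset G) \<and> admissible (set_mset G) \<and> one_loop_tree (set_mset G)"
proof (cases "signed_graph G")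
  case True
  let ?E = "set_mset G"
  have valid: "valid_edge e" if "e \<in># G" for e
    using True that by (simp add: signed_graph_def)
  have adm: "admissible ?E \<longleftrightarrow> noncrossing G \<and>
     (\<forall>i j k l. (i, j, Pos) \<in># G \<and> (k, l, Pos) \<in># G \<and> i < j \<and> k < l \<longrightarrow> i < l \<and> k < j) \<and>
     (\<forall>i k l. (i, i, Pos) \<in># G \<and> (k, l, Pos) \<in># G \<and> k < l \<longrightarrow> k \<le> i \<and> i \<le> l) \<and>
     \<not> (\<exists>i j k. (i, i, Pos) \<in># G \<and> (k, j, Neg) \<in># G \<and> k < i \<and> i < j) \<and>
     \<not> (\<exists>i j k l. (i, j, Pos) \<in># G \<and> (k, l, Neg) \<in># G \<and> k \<le> i \<and> i < j \<and> j \<le> l)"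
    using True by (simp add: admissible_iff noncrossing_def signed_graph_def)
  have loop_unique: "(\<exists>!r. \<exists>s. (r, r, s) \<in> ?E) \<longleftrightarrow> card {e \<in> ?E. is_loop e} = 1"
  proof
    assume "\<exists>!r. \<exists>s. (r, r, s) \<in> ?E"
    then obtain r s where r: "(r, r, s) \<in> ?E" "\<And>q t. (q, q, t) \<in> ?E \<Longrightarrow> q = r"
      by blast
    moreover have "t = Pos" if "(q, q, t) \<in> ?E" for q t
      using valid[OF that] by simp
    ultimately have "q = r \<and> t = Pos" if "(q, q, t) \<in> ?E" for q t
      using that by blast
    then have "e = (r, r, Pos)" if "e \<in> ?E" "is_loop e" for e
      using that by (cases e) force
    moreover have "(r, r, Pos) \<in> ?E"
      using r(1) valid[OF r(1)] by simp
    moreover have "is_loop (r, r, Pos)"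
      by simp
    ultimately have "{e \<in> ?E. is_loop e} = {(r, r, Pos)}"
      by blast
    then show "card {e \<in> ?E. is_loop e} = 1"
      by simp
  next
    assume "card {e \<in> ?E. is_loop e} = 1"
    then obtain f where f: "{e \<in> ?E. is_loop e} = {f}"
      by (rule card_1_singletonE)
    obtain r r' s where [simp]: "f = (r, r', s)"
      by (cases f)
    have "f \<in> ?E \<and> is_loop f"
      using f by blast
    then have "(r, r, s) \<in> ?E"
      by auto
    moreover have "q = r" if "(q, q, t) \<in> ?E" for q t
    proof -
      have "(q, q, t) \<in> {e \<in> ?E. is_loop e}"
        using that by simp
      then show ?thesis
        unfolding f by simp
    qed
    ultimately show "\<exists>!r. \<exists>s. (r, r, s) \<in> ?E"
      by blast
  qed
  have size_loops: "size (filter_mset is_loop G) = card {e \<in> ?E. is_loop e}" if "G = mset_set ?E"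
    by (subst that) (simp add: filter_mset_mset_set)
  have "G = mset_set ?E \<and> one_loop_tree ?E \<longleftrightarrow> graph_connected G \<and>
     size (filter_mset is_loop G) = 1 \<and> \<not> (\<exists>vs es. nonloop_cycle G vs es)" (is "?L \<longleftrightarrow> ?R")
  proof
    assume L: ?L
    then have "\<not> nonloop_cycle G vs es" for vs es
      using one_loop_tree_no_cycle by metis
    then show ?R
      using L size_loops loop_unique by (simp add: one_loop_tree_def connected_edges_set_mset)
  next
    assume R: ?R
    have "count G e \<le> 1" for e
    proof (rule ccontr)
      assume "\<not> count G e \<le> 1"
      then have cnt: "2 \<le> count G e"
        by simp
      obtain i j s where [simp]: "e = (i, j, s)"
        by (cases e)
      show False
      proof (cases "i = j")
        case True
        then have "2 \<le> count (filter_mset is_loop G) e"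
          using cnt by simp
        also have "\<dots> \<le> size (filter_mset is_loop G)"
          by (rule count_le_size)
        finally show False
          using R by simp
      next
        case False
        have "mset [e, e] \<subseteq># G"
          using cnt by (auto simp: subseteq_mset_def)
        then have "nonloop_cycle G [i, j] [e, e]"
          using False unfolding nonloop_cycle_def by (auto simp: less_Suc_eq numeral_2_eq_2)
        then show False
          using R by blast
      qed
    qed
    then have G: "G = mset_set ?E"
      by (intro multiset_eqI) (metis count_eq_zero_iff count_mset_set(1,3) finite_set_mset le_antisym less_one not_less)
    \<comment> \<open>Without cycles every nonloop edge is a bridge.\<close>
    have "\<not> (adj (?E - {(i, j, s)}))\<^sup>*\<^sup>* i j" if "(i, j, s) \<in> ?E" "i \<noteq> j" for i j s
      using nonloop_cycle_if_not_bridge[of "(i, j, s)" G j i] that R by auto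
    then have "card (nonloops ?E) + 1 \<le> CARD('n)"
      by (rule bridges_card)
    moreover have "connected_edges ?E"
      using R by (simp add: connected_edges_set_mset)
    ultimately show ?L
      using G R loop_unique size_loops connected_edges_card[of ?E] by (simp add: one_loop_tree_def)
  qed
  moreover have "well_structured G \<longleftrightarrow> admissible ?E \<and> ?R"
    unfolding well_structured_def adm by (simp only: True simp_thms conj_assoc)
  ultimately show ?thesis
    by blast
next
  case False
  then have "\<not> well_structured G" "\<not> admissible (set_mset G)"
    unfolding well_structured_def signed_graph_def using admissible_valid by blast+
  then show ?thesis
    by simp
qed

section \<open>Alternating graphs\<close>

definition alternating_edges :: "'n sedge set \<Rightarrow> bool" where
  "alternating_edges E \<longleftrightarrow>
     (\<forall>u. \<forall>e\<in>E. \<forall>e'\<in>E. incident e u \<and> incident e' u \<longrightarrow> incident_sign e u = incident_sign e' u)"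

lemma alternating_edges_subset: "alternating_edges E \<Longrightarrow> F \<subseteq> E \<Longrightarrow> alternating_edges F"
  unfolding alternating_edges_def by blast

lemma edge_vec_nth_incident_sign:
  assumes "valid_edge e"
  shows "edge_vec e $ u = (if incident_sign e u = Neg then - \<bar>edge_vec e $ u\<bar> else \<bar>edge_vec e $ u\<bar>)"
proof -
  obtain i j s where "e = (i, j, s)"
    by (cases e)
  then show ?thesis
    using assms by (cases s) (auto simp: axis_def)
qed

text \<open>A loop has a single coordinate 2, any other edge two coordinates of absolute value 1.
  That the norms agree lets one linear bound serve both kinds of edges.\<close>

lemma sum_abs_edge_vec: "valid_edge e \<Longrightarrow> (\<Sum>u\<in>UNIV. \<bar>edge_vec e $ u\<bar>) = 2"
proof (cases e)
  case (fields i j s)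
  assume "valid_edge e"
  then have "\<bar>edge_vec e $ u\<bar> = of_bool (u = i) + of_bool (u = j)" for u
    unfolding fields by (auto simp: edge_vec_nth)
  then have "(\<Sum>u\<in>UNIV. \<bar>edge_vec e $ u\<bar>) = (\<Sum>u\<in>UNIV. if u = i then 1 else 0) + (\<Sum>u\<in>UNIV. if u = j then 1 else 0)"
    by (simp add: sum.distrib of_bool_def)
  then show ?thesis
    by simp
qed

text \<open>All edges at a vertex have coordinates of the same sign there. Multiplying the
  coordinates by \<open>\<sigma>\<close> makes all edge vectors nonnegative, which is the precise
  sense in which nothing cancels.\<close>

lemma alternating_edges_sign:
  fixes E :: "'n::{finite, linorder} sedge set"
  assumes "alternating_edges E" "\<forall>e\<in>E. valid_edge e"
  obtains \<sigma> :: "real ^ ('n::_)" where "\<And>u. \<bar>\<sigma> $ u\<bar> = 1"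
    and "\<And>e u. e \<in> E \<Longrightarrow> \<sigma> $ u * edge_vec e $ u = \<bar>edge_vec e $ u\<bar>"
proof
  define \<sigma> :: "real ^ ('n::_)" where
    "\<sigma> = (\<chi> u. if \<exists>e\<in>E. incident e u \<and> incident_sign e u = Neg then -1 else 1)"
  show "\<bar>\<sigma> $ u\<bar> = 1" for u
    by (simp add: \<sigma>_def)
  show "\<sigma> $ u * edge_vec e $ u = \<bar>edge_vec e $ u\<bar>" if e: "e \<in> E" for e u
  proof (cases "incident e u")
    case True
    then have "(\<exists>e\<in>E. incident e u \<and> incident_sign e u = Neg) \<longleftrightarrow> incident_sign e u = Neg"
      using assms(1) e unfolding alternating_edges_def by metis
    then show ?thesis
      using edge_vec_nth_incident_sign[of e u] assms(2) e by (auto simp: \<sigma>_def)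
  next
    case False
    then show ?thesis
      using edge_vec_nth_eq_0_iff[of e u] assms(2) e by simp
  qed
qed

lemma inner_edge_vec_le:
  assumes "\<And>u. \<bar>\<sigma> $ u\<bar> = 1" "valid_edge e"
  shows "\<sigma> \<bullet> edge_vec e \<le> 2"
proof -
  have "\<sigma> \<bullet> edge_vec e \<le> (\<Sum>u\<in>UNIV. \<bar>edge_vec e $ u\<bar>)"
    unfolding inner_vec_def using assms(1)
    by (intro sum_mono) (metis abs_ge_self abs_mult inner_real_def mult_1)
  then show ?thesis
    using sum_abs_edge_vec[OF assms(2)] by simp
qed

lemma alternating_combination_nth:
  assumes "x = (\<Sum>f\<in>E. c f *\<^sub>R edge_vec f)" 
    and "\<And>e u. e \<in> E \<Longrightarrow> \<sigma> $ u * edge_vec e $ u = \<bar>edge_vec e $ u\<bar>"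
  shows "\<sigma> $ u * x $ u = (\<Sum>f\<in>E. c f * \<bar>edge_vec f $ u\<bar>)"
  using assms(2) by (simp add: assms(1) sum_distrib_left mult.left_commute)

text \<open>As nothing cancels, the edges with positive coefficient stay within the endpoints of
  \<open>e\<close> and meet each of them. Few edges are left, and the single loop and the sign at
  \<open>j\<close> single out \<open>e\<close>.\<close>

lemma root_in_alternating_cone:
  fixes E :: "'n::{finite, linorder} sedge set"
  assumes tree: "one_loop_tree E" and valid: "\<forall>e\<in>E. valid_edge e" and alt: "alternating_edges E"
    and c: "\<And>f. 0 \<le> c f" and e: "valid_edge e" "edge_vec e = (\<Sum>f\<in>E. c f *\<^sub>R edge_vec f)"
  shows "e \<in> E"
proof -
  obtain \<sigma> :: "real ^ ('n::_)" where \<sigma>: "\<And>u. \<bar>\<sigma> $ u\<bar> = 1"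
      "\<And>e u. e \<in> E \<Longrightarrow> \<sigma> $ u * edge_vec e $ u = \<bar>edge_vec e $ u\<bar>"
    using alternating_edges_sign[OF alt valid] by blast
  have nth: "\<sigma> $ u * edge_vec e $ u = (\<Sum>f\<in>E. c f * \<bar>edge_vec f $ u\<bar>)" for u
    using alternating_combination_nth[OF e(2) \<sigma>(2)] .
  obtain i j s where ijs: "e = (i, j, s)"
    by (cases e)
  have "incident f u \<Longrightarrow> u = i \<or> u = j" if f: "f \<in> E" "0 < c f" for f u
  proof (rule ccontr)
    assume u: "incident f u" "\<not> (u = i \<or> u = j)"
    then have "edge_vec e $ u = 0"
      using edge_vec_nth_eq_0_iff[OF e(1)] ijs by auto
    then have "(\<Sum>f\<in>E. c f * \<bar>edge_vec f $ u\<bar>) = 0"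
      using nth[of u] by simp
    then have "c f * \<bar>edge_vec f $ u\<bar> = 0"
      using f c finite_sedges by (subst (asm) sum_nonneg_eq_0_iff) auto
    then show False
      using f u edge_vec_nth_eq_0_iff[of f u] valid by auto
  qed
  then have supp: "a \<in> {i, j} \<and> b \<in> {i, j}" if "(a, b, t) \<in> E" "0 < c (a, b, t)" for a b t
    using that by fastforce
  have ex: "\<exists>f\<in>E. 0 < c f \<and> incident f u" if "incident e u" for u
  proof (rule ccontr)
    assume "\<not> ?thesis"
    then have "c f * \<bar>edge_vec f $ u\<bar> = 0" if "f \<in> E" for f
      using that c[of f] edge_vec_nth_eq_0_iff[of f u] valid by (metis abs_zero less_eq_real_def mult_eq_0_iff)
    then have "\<sigma> $ u * edge_vec e $ u = 0"
      unfolding nth by (intro sum.neutral ballI)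
    then show False
      using \<sigma>(1)[of u] that edge_vec_nth_eq_0_iff[OF e(1)] by auto
  qed
  show ?thesis
  proof (cases "i = j")
    case True
    then obtain a b t where f: "(a, b, t) \<in> E" "0 < c (a, b, t)"
      using ex[of i] ijs by auto
    then have "a = i" "b = i" "t = Pos"
      using supp True valid by fastforce+
    then show ?thesis
      using f True e(1) ijs by auto
  next
    case False
    then have "i < j"
      using e(1) ijs by simp
    obtain a b t where f: "(a, b, t) \<in> E" "0 < c (a, b, t)" "a = i \<or> b = i"
      using ex[of i] ijs by auto
    obtain a' b' t' where f': "(a', b', t') \<in> E" "0 < c (a', b', t')" "a' = j \<or> b' = j"
      using ex[of j] ijs by auto
    \<comment> \<open>Loops alone would have to sit at both \<open>i\<close> and \<open>j\<close>,
      but there is only one loop. So an edge between \<open>i\<close> and \<open>j\<close>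
      occurs.\<close>
    have "\<not> ((i, i, t) \<in> E \<and> (j, j, t') \<in> E)"
      using tree False unfolding one_loop_tree_def by blast
    moreover have "a \<le> b" "a' \<le> b'"
      using f(1) f'(1) valid by auto
    ultimately obtain t'' where g: "(i, j, t'') \<in> E" "0 < c (i, j, t'')"
      using f f' supp[OF f(1,2)] supp[OF f'(1,2)] \<open>i < j\<close> by auto
    \<comment> \<open>The sign of the coordinate at the larger endpoint tells a positive edge from a
      negative one.\<close>
    have "0 \<le> \<sigma> $ j * edge_vec e $ j"
      unfolding nth using c by (intro sum_nonneg) auto
    moreover have "\<sigma> $ j * edge_vec (i, j, t'') $ j = \<bar>edge_vec (i, j, t'') $ j\<bar>"
      using \<sigma>(2) g(1) by blast
    ultimately have "t'' = s"
      using ijs False by (cases s; cases t'') (auto simp: axis_def split: if_splits)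
    then show ?thesis
      using g ijs by simp
  qed
qed

section \<open>Uniqueness of admissible alternating representations\<close>

text \<open>Coefficient functions are defined on all edges, and the graph is the support.\<close>

definition canonical :: "('n::{finite, linorder} sedge \<Rightarrow> real) \<Rightarrow> bool" where
  "canonical c \<longleftrightarrow> (\<forall>e. 0 \<le> c e) \<and> admissible {e. 0 < c e} \<and> alternating_edges {e. 0 < c e} \<and>
     (\<forall>i j. 0 < c (i, i, Pos) \<and> 0 < c (j, j, Pos) \<longrightarrow> i = j)"

definition combination :: "('n::{finite, linorder} sedge \<Rightarrow> real) \<Rightarrow> real ^ 'n::_" where
  "combination c = (\<Sum>e\<in>UNIV. c e *\<^sub>R edge_vec e)"

lemma combination_nth: "combination c $ u = (\<Sum>e\<in>UNIV. c e * edge_vec e $ u)"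
  by (simp add: combination_def)

text \<open>The support shrinks, and every clause of \<open>canonical\<close> passes to subgraphs.
  This is why \<open>canonical\<close> asks for at most one loop in place of all of (vi).\<close>

lemma canonical_upd: "canonical c \<Longrightarrow> canonical (c(e := 0))"
  unfolding canonical_def by (auto elim!: admissible_subset alternating_edges_subset)

lemma combination_upd: "combination (c(e := 0)) = combination c - c e *\<^sub>R edge_vec e"
proof -
  have "(\<Sum>f\<in>UNIV. (c(e := 0)) f *\<^sub>R edge_vec f) = (\<Sum>f\<in>UNIV - {e}. c f *\<^sub>R edge_vec f)"
    by (rule sum.mono_neutral_cong_right) (auto simp: finite_sedges)
  then show ?thesis
    unfolding combination_def by (subst (2) sum.remove[of _ e]) (simp_all add: finite_sedges)
qed

lemma canonical_valid: "canonical c \<Longrightarrow> 0 < c e \<Longrightarrow> valid_edge e"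
  unfolding canonical_def using admissible_valid by blast

lemma canonical_nonneg: "canonical c \<Longrightarrow> 0 \<le> c e"
  unfolding canonical_def by blast

lemma canonical_sign:
  fixes c :: "'n::{finite, linorder} sedge \<Rightarrow> real"
  assumes "canonical c"
  obtains \<sigma> :: "real ^ ('n::_)" where "\<And>u. \<bar>\<sigma> $ u\<bar> = 1"
    and "\<And>e u. 0 < c e \<Longrightarrow> \<sigma> $ u * edge_vec e $ u = \<bar>edge_vec e $ u\<bar>"
    and "\<And>u. \<sigma> $ u * combination c $ u = (\<Sum>e\<in>UNIV. c e * \<bar>edge_vec e $ u\<bar>)"
proof -
  obtain \<sigma> :: "real ^ ('n::_)" where \<sigma>: "\<And>u. \<bar>\<sigma> $ u\<bar> = 1"
      "\<And>e u. 0 < c e \<Longrightarrow> \<sigma> $ u * edge_vec e $ u = \<bar>edge_vec e $ u\<bar>"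
    using alternating_edges_sign[of "{e. 0 < c e}"] assms canonical_valid[OF assms]
    unfolding canonical_def by (metis mem_Collect_eq)
  have "\<sigma> $ u * (c e * edge_vec e $ u) = c e * \<bar>edge_vec e $ u\<bar>" for e u
  proof (cases "0 < c e")
    case True
    then show ?thesis
      using \<sigma>(2)[of e u] by (metis mult.left_commute)
  next
    case False
    then have "c e = 0"
      using canonical_nonneg[OF assms, of e] by simp
    then show ?thesis
      by simp
  qed
  then have "\<sigma> $ u * combination c $ u = (\<Sum>e\<in>UNIV. c e * \<bar>edge_vec e $ u\<bar>)" for u
    unfolding combination_nth sum_distrib_left by (intro sum.cong refl)
  then show ?thesis
    using that \<sigma> by blast
qed

lemma canonical_nth:
  fixes c :: "'n::{finite, linorder} sedge \<Rightarrow> real"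
  assumes c: "canonical c"
  shows "\<bar>combination c $ u\<bar> = (\<Sum>e\<in>UNIV. c e * \<bar>edge_vec e $ u\<bar>)"
proof -
  obtain \<sigma> :: "real ^ ('n::_)" where \<sigma>: "\<And>u. \<bar>\<sigma> $ u\<bar> = 1"
    "\<And>e u. 0 < c e \<Longrightarrow> \<sigma> $ u * edge_vec e $ u = \<bar>edge_vec e $ u\<bar>"
    "\<And>u. \<sigma> $ u * combination c $ u = (\<Sum>e\<in>UNIV. c e * \<bar>edge_vec e $ u\<bar>)"
    by (rule canonical_sign[OF c]) (rule that)
  have "\<bar>combination c $ u\<bar> = \<bar>\<sigma> $ u * combination c $ u\<bar>"
    using \<sigma>(1) by (simp add: abs_mult)
  also have "\<dots> = (\<Sum>e\<in>UNIV. c e * \<bar>edge_vec e $ u\<bar>)"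
    unfolding \<sigma>(3) using canonical_nonneg[OF c] by (intro abs_of_nonneg sum_nonneg) simp
  finally show ?thesis .
qed

lemma canonical_le:
  assumes "canonical c"
  shows "c e * \<bar>edge_vec e $ u\<bar> \<le> \<bar>combination c $ u\<bar>"
  unfolding canonical_nth[OF assms] using canonical_nonneg[OF assms]
  by (intro member_le_sum) (auto simp: finite_sedges)

lemma canonical_nth_sign:
  fixes c :: "'n::{finite, linorder} sedge \<Rightarrow> real"
  assumes c: "canonical c" "0 < c e" "incident e u"
  shows "0 < combination c $ u * edge_vec e $ u"
proof -
  obtain \<sigma> :: "real ^ ('n::_)" where \<sigma>: "\<And>u. \<bar>\<sigma> $ u\<bar> = 1"
    "\<And>e u. 0 < c e \<Longrightarrow> \<sigma> $ u * edge_vec e $ u = \<bar>edge_vec e $ u\<bar>"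
    "\<And>u. \<sigma> $ u * combination c $ u = (\<Sum>e\<in>UNIV. c e * \<bar>edge_vec e $ u\<bar>)"
    by (rule canonical_sign[OF c(1)]) (rule that)
  have nz: "edge_vec e $ u \<noteq> 0"
    using edge_vec_nth_eq_0_iff[OF canonical_valid[OF c(1,2)]] c(3) by simp
  then have "0 < c e * \<bar>edge_vec e $ u\<bar>"
    using c(2) by simp
  also have "\<dots> \<le> \<sigma> $ u * combination c $ u"
    unfolding \<sigma>(3) using canonical_nonneg[OF c(1)] by (intro member_le_sum) (auto simp: finite_sedges)
  finally have "0 < (\<sigma> $ u * combination c $ u) * (\<sigma> $ u * edge_vec e $ u)"
    using \<sigma>(2)[OF c(2), of u] nz by simp
  also have "\<dots> = \<bar>\<sigma> $ u\<bar> ^ 2 * (combination c $ u * edge_vec e $ u)"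
    by (simp add: power2_eq_square)
  finally show ?thesis
    using \<sigma>(1)[of u] by simp
qed

lemma canonical_Neg:
  assumes "canonical c" "0 < c (i, j, Neg)"
  shows "i < j" "0 < combination c $ i" "combination c $ j < 0"
proof -
  have ij: "i < j"
    using canonical_valid[OF assms] by auto
 then show "i < j" .
  show "0 < combination c $ i" "combination c $ j < 0"
    using canonical_nth_sign[OF assms, of i] canonical_nth_sign[OF assms, of j] ij less_imp_neq[OF ij]
    by (auto simp: axis_def split: if_splits)
qed

lemma canonical_Pos:
  assumes "canonical c" "0 < c (i, j, Pos)"
  shows "i \<le> j" "0 < combination c $ i" "0 < combination c $ j"
proof -
  show "i \<le> j"
    using canonical_valid[OF assms] by auto
  show "0 < combination c $ i" "0 < combination c $ j"
    using canonical_nth_sign[OF assms, of i] canonical_nth_sign[OF assms, of j]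
    by (auto simp: axis_def split: if_splits)
qed

text \<open>Absolute values at \<open>u\<close> add up by \<open>canonical_nth\<close>. If
  \<open>e\<close> does not exhaust the coordinate, another edge of the support must meet
  \<open>u\<close>.\<close>

lemma canonical_other_edge:
  assumes "canonical c" "c e * \<bar>edge_vec e $ u\<bar> \<noteq> \<bar>combination c $ u\<bar>"
  obtains f where "f \<noteq> e" "0 < c f" "incident f u"
proof -
  have "\<exists>f. f \<noteq> e \<and> c f * \<bar>edge_vec f $ u\<bar> \<noteq> 0"
  proof (rule ccontr)
    assume "\<not> ?thesis"
    then have "(\<Sum>f\<in>UNIV - {e}. c f * \<bar>edge_vec f $ u\<bar>) = 0"
      by (intro sum.neutral) blast
    then have "\<bar>combination c $ u\<bar> = c e * \<bar>edge_vec e $ u\<bar>"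
      unfolding canonical_nth[OF assms(1)] by (subst sum.remove[of _ e]) (simp_all add: finite_sedges)
    then show False
      using assms(2) by simp
  qed
  then obtain f where f: "f \<noteq> e" "c f \<noteq> 0" "edge_vec f $ u \<noteq> 0"
    by auto
  then have "0 < c f"
    using canonical_nonneg[OF assms(1), of f] by simp
  then show ?thesis
    using that f edge_vec_nth_eq_0_iff canonical_valid[OF assms(1)] by metis
qed

lemma canonical_edge_at:
  assumes "canonical c" "combination c $ u \<noteq> 0"
  obtains e where "0 < c e" "incident e u"
proof -
  have "\<exists>e. c e * \<bar>edge_vec e $ u\<bar> \<noteq> 0"
    using canonical_nth[OF assms(1), of u] assms(2) by (metis (no_types, lifting) abs_eq_0 sum.neutral)
  then obtain e where e: "c e \<noteq> 0" "edge_vec e $ u \<noteq> 0"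
    by auto
  then have "0 < c e"
    using canonical_nonneg[OF assms(1), of e] by simp
  then show ?thesis
    using that e edge_vec_nth_eq_0_iff canonical_valid[OF assms(1)] by metis
qed

text \<open>If neither coordinate were exhausted by \<open>(i, j, Neg)\<close>, there would be
  further edges \<open>f\<close> at \<open>i\<close> and \<open>g\<close> at \<open>j\<close>. As
  \<open>x\<close> vanishes between \<open>i\<close> and \<open>j\<close>, \<open>g\<close> is a
  negative edge that starts before \<open>i\<close> and thus spans \<open>i\<close>, and no
  \<open>f\<close> is compatible with it.\<close>

lemma canonical_coeff_Neg:
  assumes c: "canonical c" and x: "x = combination c"
    and ij: "i < j" "0 < x $ i" "x $ j < 0" and between: "\<And>u. i < u \<Longrightarrow> u < j \<Longrightarrow> x $ u = 0"
  shows "c (i, j, Neg) = min (x $ i) (- x $ j)"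
proof (rule ccontr)
  let ?e = "(i, j, Neg)"
  assume "\<not> ?thesis"
  moreover have "c ?e \<le> x $ i" "c ?e \<le> - x $ j"
    using canonical_le[OF c, of ?e i] canonical_le[OF c, of ?e j] ij by (auto simp: axis_def x split: if_splits)
  ultimately have less: "c ?e \<noteq> x $ i" "c ?e \<noteq> - x $ j"
    by auto
  have adm: "admissible {e. 0 < c e}"
    using c by (simp add: canonical_def)
  have "c ?e * \<bar>edge_vec ?e $ i\<bar> \<noteq> \<bar>combination c $ i\<bar>"
    using less(1) ij less_imp_neq[OF ij(1)] by (auto simp: axis_def x)
  then obtain f where f: "f \<noteq> ?e" "0 < c f" "incident f i"
    by (rule canonical_other_edge[OF c])
  have "c ?e * \<bar>edge_vec ?e $ j\<bar> \<noteq> \<bar>combination c $ j\<bar>"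
    using less(2) ij less_imp_neq[OF ij(1)] by (auto simp: axis_def x)
  then obtain g where g: "g \<noteq> ?e" "0 < c g" "incident g j"
    by (rule canonical_other_edge[OF c])
  obtain k where k: "g = (k, j, Neg)" "k < i"
  proof -
    obtain k l s where kls: "g = (k, l, s)"
      by (cases g)
    have "s = Neg"
      using canonical_Pos[OF c, of k l] g kls ij(3) x by (cases s) auto
    then have kl: "k < l" "0 < x $ k" "x $ l < 0"
      using canonical_Neg[OF c, of k l] g kls x by auto
    then have "l = j"
      using g kls ij(3) by auto
    moreover have "k \<noteq> i"
      using g(1) kls \<open>s = Neg\<close> \<open>l = j\<close> by simp
    then have "k < i"
      using between[of k] kl \<open>l = j\<close> by force
    ultimately show ?thesis
      using that kls \<open>s = Neg\<close> by blast
  qed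
  have gE: "(k, j, Neg) \<in> {e. 0 < c e}"
    using g k by simp
  obtain a b s where abs: "f = (a, b, s)"
    by (cases f)
  have fE: "(a, b, s) \<in> {e. 0 < c e}"
    using f abs by simp
  show False
  proof (cases s)
    case Neg
    then have "a < b" "0 < x $ a" "x $ b < 0"
      using canonical_Neg[OF c, of a b] f abs x by auto
    then have "a = i" "j < b"
      using f abs Neg between[of b] ij by (auto, force)
    then show False
      using admissible_noncrossing[OF adm gE fE] k ij by simp
  next
    case Pos
    then have ab: "a \<le> b" "0 < x $ a" "0 < x $ b"
      using canonical_Pos[OF c, of a b] f abs x by auto
    \<comment> \<open>Against \<open>g\<close> the loop violates (iv), an edge to the right crosses,
      and an edge to the left crosses or violates (v).\<close>
    consider "a = i" "b = i" | "a = i" "i < b" | "b = i" "a < i"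
      using f(3) abs ab(1) by fastforce
    then show False
    proof cases
      case 1
      then show False
        using admissible_loop_neg[OF adm _ gE] fE Pos k ij by simp
    next
      case 2
      then have "j < b"
        using between[of b] ab ij by (metis less_irrefl linorder_neqE order.asym)
      then show False
        using admissible_noncrossing[OF adm gE fE] 2 k ij by simp
    next
      case 3
      show False
      proof (cases "a < k")
        case True
        then show False
          using admissible_noncrossing[OF adm fE gE] 3 k ij by simp
      next
        case False
        then show False
          using admissible_pos_neg[OF adm _ gE] fE Pos 3 ij by force
      qed
    qed
  qed
qed

text \<open>Nonnegative coordinates allow only positive edges, all within \<open>a\<close> and
  \<open>b\<close>. If neither extreme coordinate were exhausted, there would be \<open>f\<close>
  from \<open>a\<close> ending before \<open>b\<close> and \<open>g\<close> into \<open>b\<close>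
  starting after \<open>a\<close>.\<close>

lemma canonical_coeff_Pos:
  assumes c: "canonical c" and x: "x = combination c" and nonneg: "\<And>u. 0 \<le> x $ u"
    and ab: "a < b" "0 < x $ a" "0 < x $ b" and supp: "\<And>u. 0 < x $ u \<Longrightarrow> a \<le> u \<and> u \<le> b"
  shows "c (a, b, Pos) = min (x $ a) (x $ b)"
proof (rule ccontr)
  let ?e = "(a, b, Pos)"
  assume "\<not> ?thesis"
  moreover have "c ?e \<le> x $ a" "c ?e \<le> x $ b"
    using canonical_le[OF c, of ?e a] canonical_le[OF c, of ?e b] ab by (auto simp: axis_def x split: if_splits)
  ultimately have less: "c ?e \<noteq> x $ a" "c ?e \<noteq> x $ b"
    by auto
  have adm: "admissible {e. 0 < c e}"
    using c by (simp add: canonical_def)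
  have edge: "\<exists>k l. f = (k, l, Pos) \<and> a \<le> k \<and> k \<le> l \<and> l \<le> b" if f: "0 < c f" for f
  proof -
    obtain k l s where kls: "f = (k, l, s)"
      by (cases f)
    have "s = Pos"
      using canonical_Neg(3)[OF c, of k l] f kls nonneg[of l] x by (cases s) auto
    then show ?thesis
      using canonical_Pos[OF c, of k l] f kls supp x by auto
  qed
  have "c ?e * \<bar>edge_vec ?e $ a\<bar> \<noteq> \<bar>combination c $ a\<bar>"
    using less(1) ab less_imp_neq[OF ab(1)] by (auto simp: axis_def x)
  then obtain f where f: "f \<noteq> ?e" "0 < c f" "incident f a"
    by (rule canonical_other_edge[OF c])
  have "c ?e * \<bar>edge_vec ?e $ b\<bar> \<noteq> \<bar>combination c $ b\<bar>"
    using less(2) ab less_imp_neq[OF ab(1)] by (auto simp: axis_def x)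
  then obtain g where g: "g \<noteq> ?e" "0 < c g" "incident g b"
    by (rule canonical_other_edge[OF c])
  obtain l where l: "f = (a, l, Pos)" "a \<le> l" "l < b"
    using edge[OF f(2)] f by fastforce
  obtain k where k: "g = (k, b, Pos)" "a < k" "k \<le> b"
    using edge[OF g(2)] g by fastforce
  have fE: "(a, l, Pos) \<in> {e. 0 < c e}" and gE: "(k, b, Pos) \<in> {e. 0 < c e}"
    using f g k l by auto
  \<comment> \<open>Two loops are excluded by \<open>canonical\<close>, one loop violates (iii), and
    for two nonloop edges (ii) makes them overlap, hence cross.\<close>
  consider "a = l" "k = b" | "a = l" "k < b" | "a < l" "k = b" | "a < l" "k < b"
    using k l by fastforce
  then show False
  proof cases
    case 1
    then show False
      using c fE gE ab by (auto simp: canonical_def)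
  next
    case 2
    then show False
      using admissible_loop_pos[OF adm _ gE] fE k by force
  next
    case 3
    then show False
      using admissible_loop_pos[OF adm _ fE] gE l by force
  next
    case 4
    then have "k < l"
      using admissible_pos_pos[OF adm gE fE] by blast
    then show False
      using admissible_noncrossing[OF adm fE gE] k l by blast
  qed
qed

lemma canonical_coeff_loop:
  assumes c: "canonical c" and x: "x = combination c"
    and a: "0 < x $ a" and supp: "\<And>u. x $ u \<noteq> 0 \<Longrightarrow> u = a"
  shows "c (a, a, Pos) = x $ a / 2"
proof (rule ccontr)
  let ?e = "(a, a, Pos)"
  assume "\<not> ?thesis"
  then have "c ?e * \<bar>edge_vec ?e $ a\<bar> \<noteq> \<bar>combination c $ a\<bar>"
    using a by (auto simp: axis_def x)
  then obtain f where f: "f \<noteq> ?e" "0 < c f" "incident f a"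
    by (rule canonical_other_edge[OF c])
  obtain k l s where kls: "f = (k, l, s)"
    by (cases f)
  show False
    using canonical_Neg[OF c, of k l] canonical_Pos[OF c, of k l] f kls supp[of k] supp[of l] x
    by (cases s) auto
qed

text \<open>The point of the choice is that \<open>e\<close> and \<open>m\<close> are read off from
  \<open>x\<close> alone, so they agree for all canonical representations of \<open>x\<close>.
  Subtracting clears a coordinate and creates no new one.\<close>

lemma canonical_peel:
  assumes c: "canonical c" and x: "x = combination c" "x \<noteq> 0"
  obtains e m where "\<And>d. canonical d \<Longrightarrow> x = combination d \<Longrightarrow> d e = m"
    and "card {u. (x - m *\<^sub>R edge_vec e) $ u \<noteq> 0} < card {u. x $ u \<noteq> 0}"
proof -
  have smaller: "card {u. (x - m *\<^sub>R edge_vec e) $ u \<noteq> 0} < card {u. x $ u \<noteq> 0}"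
    if "\<And>u. x $ u = 0 \<Longrightarrow> edge_vec e $ u = 0" "x $ w \<noteq> 0" "x $ w = m * edge_vec e $ w" for e w m
    using that by (intro psubset_card_mono) auto
  show ?thesis
  proof (cases "\<exists>j. x $ j < 0")
    case True
    \<comment> \<open>The first negative coordinate and the last positive one before it have only
      zeros between them.\<close>
    define j where "j = Min {j. x $ j < 0}"
    have j: "x $ j < 0" and j_min: "\<And>u. x $ u < 0 \<Longrightarrow> j \<le> u"
      using True Min_in[of "{j. x $ j < 0}"] unfolding j_def by (auto intro: Min_le)
    obtain e where e: "0 < c e" "incident e j"
      using canonical_edge_at[OF c] j x by (metis less_irrefl)
    obtain k l s where kls: "e = (k, l, s)"
      by (cases e)
    have "\<exists>i. i < j \<and> 0 < x $ i"
      using canonical_Neg[OF c, of k l] canonical_Pos[OF c, of k l] e kls j x by (cases s) auto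
    then have ne: "{i. i < j \<and> 0 < x $ i} \<noteq> {}"
      by blast
    define i where "i = Max {i. i < j \<and> 0 < x $ i}"
    have i: "i < j" "0 < x $ i" and i_max: "\<And>u. u < j \<Longrightarrow> 0 < x $ u \<Longrightarrow> u \<le> i"
      using Max_in[OF _ ne] unfolding i_def by (auto intro: Max_ge)
    have between: "x $ u = 0" if "i < u" "u < j" for u
      using i_max[of u] j_min[of u] that by force
    define m where "m = min (x $ i) (- x $ j)"
    show ?thesis
    proof (rule that)
      show "d (i, j, Neg) = m" if "canonical d" "x = combination d" for d
        unfolding m_def using canonical_coeff_Neg[OF that i(1,2) j between] .
      show "card {u. (x - m *\<^sub>R edge_vec (i, j, Neg)) $ u \<noteq> 0} < card {u. x $ u \<noteq> 0}"
        \<comment> \<open>The coordinate that attains the minimum is cleared.\<close>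
        by (rule smaller[where w = "if x $ i \<le> - x $ j then i else j"])
          (use i j in \<open>auto simp: m_def axis_def\<close>)
    qed
  next
    case False
    then have nonneg: "0 \<le> x $ u" for u
      by (simp add: not_less)
    define S where "S = {u. 0 < x $ u}"
    have "\<exists>u. x $ u \<noteq> 0"
      using x(2) by (simp add: vec_eq_iff)
    then have "S \<noteq> {}"
      using nonneg unfolding S_def by (auto simp: less_le)
    define a b where "a = Min S" and "b = Max S"
    have ab: "0 < x $ a" "0 < x $ b" and supp: "\<And>u. 0 < x $ u \<Longrightarrow> a \<le> u \<and> u \<le> b"
      using Min_in[of S] Max_in[of S] \<open>S \<noteq> {}\<close> unfolding a_def b_def S_def by auto
    show ?thesis
    proof (cases "a = b")
      case True
      show ?thesis
      proof (rule that)
        show "d (a, a, Pos) = x $ a / 2" if "canonical d" "x = combination d" for d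
          using that ab(1)
        proof (rule canonical_coeff_loop)
          show "u = a" if "x $ u \<noteq> 0" for u
            using supp[of u] True nonneg[of u] that by auto
        qed
        show "card {u. (x - (x $ a / 2) *\<^sub>R edge_vec (a, a, Pos)) $ u \<noteq> 0} < card {u. x $ u \<noteq> 0}"
          by (rule smaller[where w = a]) (use ab in \<open>auto simp: axis_def\<close>)
      qed
    next
      case False
      then have "a < b"
        using supp[OF ab(1)] by simp
      define m where "m = min (x $ a) (x $ b)"
      show ?thesis
      proof (rule that)
        show "d (a, b, Pos) = m" if "canonical d" "x = combination d" for d
          unfolding m_def using canonical_coeff_Pos[OF that nonneg \<open>a < b\<close> ab supp] .
        show "card {u. (x - m *\<^sub>R edge_vec (a, b, Pos)) $ u \<noteq> 0} < card {u. x $ u \<noteq> 0}"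
          by (rule smaller[where w = "if x $ a \<le> x $ b then a else b"])
            (use ab False in \<open>auto simp: m_def axis_def\<close>)
      qed
    qed
  qed
qed

text \<open>Induction on the number of nonzero coordinates: both representations lose the same edge
  with the same coefficient.\<close>

lemma canonical_unique:
  assumes "canonical c" "canonical d" "combination c = combination d"
  shows "c = d"
  using assms
proof (induction "card {u. combination c $ u \<noteq> 0}" arbitrary: c d rule: less_induct)
  case less
  show ?case
  proof (cases "combination c = 0")
    case True
    have z: "b e = 0" if "canonical b" "combination b = 0" for b e
    proof (rule ccontr)
      assume "b e \<noteq> 0"
      then have "0 < b e"
        using canonical_nonneg[OF that(1), of e] by simp
      moreover obtain i j s where "e = (i, j, s)"
        by (cases e)
      ultimately show False
        using canonical_nth_sign[OF that(1), of e i] that(2) by simp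
    qed
    show ?thesis
      using z[OF less.prems(1)] z[OF less.prems(2)] True less.prems(3) by (intro ext) simp
  next
    case False
    obtain e m where e: "\<And>b. canonical b \<Longrightarrow> combination c = combination b \<Longrightarrow> b e = m"
      and smaller: "card {u. (combination c - m *\<^sub>R edge_vec e) $ u \<noteq> 0} < card {u. combination c $ u \<noteq> 0}"
      by (rule canonical_peel[OF less.prems(1) refl False]) (rule that)
    have m: "c e = m" "d e = m"
      using e[OF less.prems(1) refl] e[OF less.prems(2,3)] by simp_all
    have "c(e := 0) = d(e := 0)"
    proof (rule less.hyps)
      show "card {u. combination (c(e := 0)) $ u \<noteq> 0} < card {u. combination c $ u \<noteq> 0}"
        unfolding combination_upd m by (rule smaller)
      show "combination (c(e := 0)) = combination (d(e := 0))"
        unfolding combination_upd m less.prems(3) ..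
    qed (rule canonical_upd less.prems)+
    then show ?thesis
      using m by (metis fun_upd_triv fun_upd_upd)
  qed
qed

section \<open>Reductions of well-structured graphs\<close>

definition edge_cone :: "'n::finite sedge set \<Rightarrow> (real ^ 'n::_) set" where
  "edge_cone E = {\<Sum>e\<in>E. c e *\<^sub>R edge_vec e | c. \<forall>e. 0 \<le> c e}"

lemma edge_coneI:
  assumes "\<And>e. e \<in> E \<Longrightarrow> 0 \<le> c e"
  shows "(\<Sum>e\<in>E. c e *\<^sub>R edge_vec e) \<in> edge_cone E"
proof -
  \<comment> \<open>The definition wants coefficients that are nonnegative everywhere, so values
    outside \<open>E\<close> are cut off at 0.\<close>
  have "(\<Sum>e\<in>E. c e *\<^sub>R edge_vec e) = (\<Sum>e\<in>E. max 0 (c e) *\<^sub>R edge_vec e)"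
    using assms by (intro sum.cong) auto
  then show ?thesis
    unfolding edge_cone_def by (intro CollectI exI[of _ "\<lambda>e. max 0 (c e)"]) auto
qed

lemma edge_coneE:
  assumes "x \<in> edge_cone E"
  obtains c where "\<And>e. 0 \<le> c e" "x = (\<Sum>e\<in>E. c e *\<^sub>R edge_vec e)"
  using assms unfolding edge_cone_def by blast

lemma edge_cone_add:
  assumes "x \<in> edge_cone E" "y \<in> edge_cone E"
  shows "x + y \<in> edge_cone E"
proof -
  obtain b where b: "\<And>e. 0 \<le> b e" "x = (\<Sum>e\<in>E. b e *\<^sub>R edge_vec e)"
    by (rule edge_coneE[OF assms(1)]) (rule that)
  obtain c where c: "\<And>e. 0 \<le> c e" "y = (\<Sum>e\<in>E. c e *\<^sub>R edge_vec e)"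
    by (rule edge_coneE[OF assms(2)]) (rule that)
  have "x + y = (\<Sum>e\<in>E. (b e + c e) *\<^sub>R edge_vec e)"
    by (simp add: b c scaleR_add_left sum.distrib)
  then show ?thesis
    using edge_coneI[of E "\<lambda>e. b e + c e"] b(1) c(1) by simp
qed

lemma edge_cone_scaleR:
  assumes "x \<in> edge_cone E" "0 \<le> a"
  shows "a *\<^sub>R x \<in> edge_cone E"
proof -
  obtain b where b: "\<And>e. 0 \<le> b e" "x = (\<Sum>e\<in>E. b e *\<^sub>R edge_vec e)"
    by (rule edge_coneE[OF assms(1)]) (rule that)
  have "a *\<^sub>R x = (\<Sum>e\<in>E. (a * b e) *\<^sub>R edge_vec e)"
    by (simp add: b scaleR_sum_right)
  then show ?thesis
    using edge_coneI[of E "\<lambda>e. a * b e"] b(1) assms(2) by simp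
qed

lemma edge_cone_base:
  assumes "e \<in> E"
  shows "edge_vec e \<in> edge_cone E"
proof -
  have "(\<Sum>f\<in>E. of_bool (f = e) *\<^sub>R edge_vec f) = (\<Sum>f\<in>E. if f = e then edge_vec f else 0)"
    by (rule sum.cong) auto
  also have "\<dots> = edge_vec e"
    using assms by (simp add: finite_sedges)
  finally show ?thesis
    using edge_coneI[of E "\<lambda>f. of_bool (f = e)"] by simp
qed

lemma edge_cone_0: "0 \<in> edge_cone E"
  using edge_coneI[of E "\<lambda>e. 0"] by simp

lemma edge_cone_mono:
  assumes "edge_vec ` E \<subseteq> edge_cone F"
  shows "edge_cone E \<subseteq> edge_cone F"
proof
  fix x assume "x \<in> edge_cone E"
  then obtain c where c: "\<And>e. 0 \<le> c e" "x = (\<Sum>e\<in>E. c e *\<^sub>R edge_vec e)"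
    using edge_coneE by blast
  have "finite E"
    by (rule finite_sedges)
  then have "(\<Sum>e\<in>E. c e *\<^sub>R edge_vec e) \<in> edge_cone F"
    using assms
    by (induction E rule: finite_induct)
      (auto intro!: edge_cone_0 edge_cone_add edge_cone_scaleR c(1))
  then show "x \<in> edge_cone F"
    using c(2) by simp
qed

text \<open>The smaller of the two coefficients moves to \<open>g\<close>, its edge disappears, and
  the other edge keeps the difference.\<close>

lemma edge_cone_exchange:
  assumes x: "x \<in> edge_cone E" and ef: "e \<in> E" "f \<in> E" "e \<noteq> f" "g \<notin> E"
    and g: "edge_vec g = edge_vec e + edge_vec f"
  shows "x \<in> edge_cone (insert g (E - {e})) \<or> x \<in> edge_cone (insert g (E - {f}))"
proof -
  obtain c where c: "\<And>e. 0 \<le> c e" "x = (\<Sum>e\<in>E. c e *\<^sub>R edge_vec e)"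
    by (rule edge_coneE[OF x]) (rule that)
  define R where "R = (\<Sum>e\<in>E - {e, f}. c e *\<^sub>R edge_vec e)"
  have fin: "finite E" "finite (E - {e, f})"
    by (rule finite_sedges)+
  have sum_eq: "(\<Sum>e\<in>insert g (insert a (E - {e, f})). d e *\<^sub>R edge_vec e) =
      d g *\<^sub>R edge_vec g + d a *\<^sub>R edge_vec a + R"
    if "a = e \<or> a = f" "\<And>h. h \<in> E - {e, f} \<Longrightarrow> d h = c h" for a d
  proof -
    have "g \<notin> insert a (E - {e, f})" "a \<notin> E - {e, f}"
      using that(1) ef by auto
    moreover have "(\<Sum>e\<in>E - {e, f}. d e *\<^sub>R edge_vec e) = R"
      unfolding R_def using that(2) by (intro sum.cong) auto
    ultimately show ?thesis
      using fin by simp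
  qed
  have "E = insert e (insert f (E - {e, f}))"
    using ef by auto
  then have "x = (\<Sum>e\<in>insert e (insert f (E - {e, f})). c e *\<^sub>R edge_vec e)"
    using c(2) by simp
  also have "\<dots> = c e *\<^sub>R edge_vec e + c f *\<^sub>R edge_vec f + R"
    using fin ef(3) by (simp add: R_def)
  finally have x_eq: "x = c e *\<^sub>R edge_vec e + c f *\<^sub>R edge_vec f + R" .
  show ?thesis
  proof (cases "c e \<le> c f")
    case True
    define d where "d = c(g := c e, f := c f - c e)"
    have "x = d g *\<^sub>R edge_vec g + d f *\<^sub>R edge_vec f + R"
      using ef by (auto simp: x_eq d_def g algebra_simps)
    also have "\<dots> = (\<Sum>e\<in>insert g (insert f (E - {e, f})). d e *\<^sub>R edge_vec e)"
      using ef by (subst sum_eq) (auto simp: d_def)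
    also have "insert g (insert f (E - {e, f})) = insert g (E - {e})"
      using ef by auto
    also have "(\<Sum>e\<in>insert g (E - {e}). d e *\<^sub>R edge_vec e) \<in> edge_cone (insert g (E - {e}))"
      using c(1) True by (intro edge_coneI) (simp add: d_def)
    finally show ?thesis ..
  next
    case False
    define d where "d = c(g := c f, e := c e - c f)"
    have "x = d g *\<^sub>R edge_vec g + d e *\<^sub>R edge_vec e + R"
      using ef by (auto simp: x_eq d_def g algebra_simps)
    also have "\<dots> = (\<Sum>e\<in>insert g (insert e (E - {e, f})). d e *\<^sub>R edge_vec e)"
      using ef by (subst sum_eq) (auto simp: d_def)
    also have "insert g (insert e (E - {e, f})) = insert g (E - {f})"
      using ef by auto
    also have "(\<Sum>e\<in>insert g (E - {f}). d e *\<^sub>R edge_vec e) \<in> edge_cone (insert g (E - {f}))"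
      using c(1) False by (intro edge_coneI) (simp add: d_def)
    finally show ?thesis ..
  qed
qed

text \<open>The potential that increases with each reduction: the functional \<open>e\<^sub>u \<mapsto> n + 1 - u\<close> is positive on positive roots.\<close>

definition edge_height :: "'n::{finite, linorder} sedge \<Rightarrow> real" where
  "edge_height e = (\<chi> u. real (card {u..})) \<bullet> edge_vec e"

lemma edge_height_pos:
  fixes e :: "'n::{finite, linorder} sedge"
  assumes "valid_edge e"
  shows "0 < edge_height e"
proof -
  obtain i j s where e: "e = (i, j, s)"
    by (cases e)
  have pos: "0 < card {u..}" for u :: 'n
    by (subst card_gt_0_iff) auto
  show ?thesis
  proof (cases s)
    case Pos
    then show ?thesis
      using pos by (simp add: e edge_height_def inner_add_right inner_axis add_pos_pos)
  next
    case Neg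
    then have "i < j"
      using assms e by auto
    then have "card {j..} < card {i..}"
      by (intro psubset_card_mono) auto
    then show ?thesis
      using Neg by (simp add: e edge_height_def inner_diff_right inner_axis)
  qed
qed

lemma edge_height_add:
  "edge_vec g = edge_vec e + edge_vec f \<Longrightarrow> edge_height g = edge_height e + edge_height f"
  by (simp add: edge_height_def inner_add_right)

lemma sum_height_exchange:
  assumes "e \<in> E" "g \<notin> E"
  shows "sum edge_height (insert g (E - {e})) = sum edge_height E - edge_height e + edge_height g"
  using assms by (simp add: finite_sedges sum_diff1)

text \<open>The given path replaces \<open>e\<close> in every walk, and the number of nonloop edges
  stays the same; no cycles have to be traced.\<close>

lemma one_loop_tree_exchange:
  assumes tree: "one_loop_tree E" and e: "e \<in> E" "\<not> is_loop e" "joins e a b"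
    and g: "g \<notin> E" "\<not> is_loop g" and path: "(adj (insert g (E - {e})))\<^sup>*\<^sup>* a b"
  shows "one_loop_tree (insert g (E - {e}))"
proof -
  let ?E = "insert g (E - {e})"
  have "connected_edges ?E"
  proof (rule connected_edges_transfer)
    show "connected_edges E"
      using tree by (simp add: one_loop_tree_def)
    fix f u w assume f: "f \<in> E" "joins f u w"
    show "(adj ?E)\<^sup>*\<^sup>* u w"
    proof (cases "f = e")
      case True
      then have "u = a \<and> w = b \<or> u = b \<and> w = a"
        using f(2) e(3) by (cases e) auto
      then show ?thesis
        using path adj_rtranclp_sym by metis
    next
      case False
      then show ?thesis
        using f by (intro r_into_rtranclp) (auto simp: adj_def)
    qed
  qed
  moreover have "nonloops ?E = insert g (nonloops E - {e})"
    using g e by (auto simp: nonloops_def)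
  then have "card (nonloops ?E) = card (nonloops E)"
    using g e card_Suc_Diff1[of "nonloops E" e] by (simp add: finite_sedges nonloops_def)
  moreover have "(r, r, s) \<in> ?E \<longleftrightarrow> (r, r, s) \<in> E" for r s
    using g e by auto
  ultimately show ?thesis
    using tree unfolding one_loop_tree_def by simp
qed

text \<open>A loop does not contribute to connectedness, so it may sit at any vertex.\<close>

lemma one_loop_tree_move_loop:
  assumes tree: "one_loop_tree E" and j: "(j, j, Pos) \<in> E" and valid: "\<forall>e\<in>E. valid_edge e"
  shows "one_loop_tree (insert (i, i, Pos) (E - {(j, j, Pos)}))"
proof -
  let ?E = "insert (i, i, Pos) (E - {(j, j, Pos)})"
  have loop: "r = j \<and> s = Pos" if "(r, r, s) \<in> E" for r s
  proof
    show "r = j"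
      using tree j that unfolding one_loop_tree_def by blast
    show "s = Pos"
      using valid that by fastforce
  qed
  have "connected_edges ?E"
  proof (rule connected_edges_transfer)
    show "connected_edges E"
      using tree by (simp add: one_loop_tree_def)
    fix f u w assume f: "f \<in> E" "joins f u w"
    show "(adj ?E)\<^sup>*\<^sup>* u w"
    proof (cases "f = (j, j, Pos)")
      case True
      then show ?thesis
        using f(2) by simp
    next
      case False
      then show ?thesis
        using f by (intro r_into_rtranclp) (auto simp: adj_def)
    qed
  qed
  moreover have "nonloops ?E = nonloops E"
    by (auto simp: nonloops_def)
  moreover have "(r, r, s) \<in> ?E \<longleftrightarrow> r = i \<and> s = Pos" for r s
    using loop by auto
  ultimately show ?thesis
    using tree unfolding one_loop_tree_def by simp
qed

text \<open>The hypotheses list the ways in which the new edge can fail: \<open>right\<close> and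
  \<open>left\<close> are the two crossings, \<open>pos\<close>, \<open>loop\<close> and
  \<open>neg\<close> are (ii), (iii) and (v). The two lemmas after this one are read in the same
  way.\<close>

lemma admissible_insert_Pos:
  assumes E: "admissible E" and ab: "a < b"
    and right: "\<And>k l t. (k, l, t) \<in> E \<Longrightarrow> a < k \<Longrightarrow> k < b \<Longrightarrow> b < l \<Longrightarrow> False"
    and left: "\<And>k l t. (k, l, t) \<in> E \<Longrightarrow> k < a \<Longrightarrow> a < l \<Longrightarrow> l < b \<Longrightarrow> False"
    and pos: "\<And>k l. (k, l, Pos) \<in> E \<Longrightarrow> k < l \<Longrightarrow> a < l \<and> k < b"
    and loop: "\<And>m. (m, m, Pos) \<in> E \<Longrightarrow> a \<le> m \<and> m \<le> b"
    and neg: "\<And>k l. (k, l, Neg) \<in> E \<Longrightarrow> k \<le> a \<Longrightarrow> b \<le> l \<Longrightarrow> False"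
  shows "admissible (insert (a, b, Pos) E)"
proof (rule admissible_insert[OF E])
  show "compatible (a, b, Pos) (k, l, t) \<and> compatible (k, l, t) (a, b, Pos)" if "(k, l, t) \<in> E" for k l t
    using right[OF that] left[OF that] pos[of k l] loop[of k] neg[of k l] that ab by auto
qed (use ab in auto)

lemma admissible_insert_Neg:
  assumes E: "admissible E" and ab: "a < b"
    and right: "\<And>k l t. (k, l, t) \<in> E \<Longrightarrow> a < k \<Longrightarrow> k < b \<Longrightarrow> b < l \<Longrightarrow> False"
    and left: "\<And>k l t. (k, l, t) \<in> E \<Longrightarrow> k < a \<Longrightarrow> a < l \<Longrightarrow> l < b \<Longrightarrow> False"
    and loop: "\<And>m. (m, m, Pos) \<in> E \<Longrightarrow> a < m \<Longrightarrow> m < b \<Longrightarrow> False"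
    and pos: "\<And>k l. (k, l, Pos) \<in> E \<Longrightarrow> a \<le> k \<Longrightarrow> k < l \<Longrightarrow> l \<le> b \<Longrightarrow> False"
  shows "admissible (insert (a, b, Neg) E)"
proof (rule admissible_insert[OF E])
  show "compatible (a, b, Neg) (k, l, t) \<and> compatible (k, l, t) (a, b, Neg)" if "(k, l, t) \<in> E" for k l t
    using right[OF that] left[OF that] pos[of k l] loop[of k] that ab by auto
qed (use ab in auto)

lemma admissible_insert_loop:
  assumes E: "admissible E"
    and pos: "\<And>k l. (k, l, Pos) \<in> E \<Longrightarrow> k < l \<Longrightarrow> k \<le> m \<and> m \<le> l"
    and neg: "\<And>k l. (k, l, Neg) \<in> E \<Longrightarrow> k < m \<Longrightarrow> m < l \<Longrightarrow> False"
  shows "admissible (insert (m, m, Pos) E)"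
proof (rule admissible_insert[OF E])
  show "compatible (m, m, Pos) (k, l, t) \<and> compatible (k, l, t) (m, m, Pos)" if "(k, l, t) \<in> E" for k l t
    using pos[of k l] neg[of k l] that by auto
qed auto

text \<open>The new edge closes a triangle with \<open>e\<close> and \<open>f\<close>, so it may
  replace either of them, and \<open>edge_cone_exchange\<close> decides which. Admissibility with
  all three edges present covers both outcomes. The height grows because that of \<open>g\<close> is
  the sum of two positive heights.\<close>

lemma reduce_triangle:
  assumes tree: "one_loop_tree E" and adm: "admissible (insert g E)"
    and x: "x \<in> edge_cone E" and ef: "e \<in> E" "f \<in> E"
    and g: "edge_vec g = edge_vec e + edge_vec f"
    and joins: "joins e a b" "joins f b c" "joins g a c" and ne: "a \<noteq> b" "b \<noteq> c" "a \<noteq> c"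
  shows "\<exists>E'. one_loop_tree E' \<and> admissible E' \<and> x \<in> edge_cone E' \<and>
    edge_vec ` E' \<subseteq> edge_cone E \<and> sum edge_height E < sum edge_height E'"
proof -
  have nl: "\<not> is_loop e" "\<not> is_loop f" "\<not> is_loop g"
    using joins ne by (cases e; cases f; cases g; auto)+
  have neq: "e \<noteq> f" "e \<noteq> g" "f \<noteq> g"
    using joins ne by (cases e; cases f; cases g; auto)+
  have sym: "joins e b a" "joins f c b"
    using joins joins_sym by metis+
  have "g \<notin> E"
  proof
    assume "g \<in> E"
    then show False
      using one_loop_tree_no_triangle[OF tree ef(1) _ ef(2) neq(2,1) joins(1,3) sym(2) ne(1)] by blast
  qed
  have "edge_vec ` insert g E \<subseteq> edge_cone E"
    using g ef by (auto intro: edge_cone_base edge_cone_add)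
  then have sub: "edge_vec ` insert g (E - S) \<subseteq> edge_cone E" for S
    by blast
  have val: "valid_edge e" "valid_edge f"
    using adm ef admissible_valid by blast+
  have height: "edge_height e < edge_height g" "edge_height f < edge_height g"
    using edge_height_pos[OF val(1)] edge_height_pos[OF val(2)] edge_height_add[OF g] by auto
  have adm': "admissible (insert g (E - S))" for S
    by (rule admissible_subset[OF adm]) auto
  have "one_loop_tree (insert g (E - {e}))"
  proof (rule one_loop_tree_exchange[OF tree ef(1) nl(1) joins(1) \<open>g \<notin> E\<close> nl(3)])
    have "adj (insert g (E - {e})) a c" "adj (insert g (E - {e})) c b"
      using joins sym ef neq by (auto simp: adj_def)
    then show "(adj (insert g (E - {e})))\<^sup>*\<^sup>* a b"
      by (meson r_into_rtranclp rtranclp_trans)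
  qed
  moreover have "one_loop_tree (insert g (E - {f}))"
  proof (rule one_loop_tree_exchange[OF tree ef(2) nl(2) joins(2) \<open>g \<notin> E\<close> nl(3)])
    have "adj (insert g (E - {f})) b a" "adj (insert g (E - {f})) a c"
      using joins sym ef neq by (auto simp: adj_def)
    then show "(adj (insert g (E - {f})))\<^sup>*\<^sup>* b c"
      by (meson r_into_rtranclp rtranclp_trans)
  qed
  moreover have "sum edge_height E < sum edge_height (insert g (E - {e}))"
      "sum edge_height E < sum edge_height (insert g (E - {f}))"
    using height sum_height_exchange ef \<open>g \<notin> E\<close> by fastforce+
  ultimately show ?thesis
    using edge_cone_exchange[OF x ef neq(1) \<open>g \<notin> E\<close> g] adm' sub by blast
qed

text \<open>Replacing the loop by \<open>(i, j, Pos)\<close> would leave a graph without loops. In that case a second exchange brings in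
  \<open>(i, i, Pos)\<close>, whose vector is the sum of those of \<open>(i, j, Neg)\<close> and \<open>(i, j, Pos)\<close>.\<close>

lemma reduce_loop:
  assumes tree: "one_loop_tree E" and E: "admissible E" and x: "x \<in> edge_cone E"
    and e: "(i, j, Neg) \<in> E" and f: "(j, j, Pos) \<in> E"
    and i_min: "\<And>k. (k, j, Neg) \<in> E \<Longrightarrow> i \<le> k" and no_right: "\<And>b. (j, b, Pos) \<in> E \<Longrightarrow> b \<le> j"
  shows "\<exists>E'. one_loop_tree E' \<and> admissible E' \<and> x \<in> edge_cone E' \<and>
    edge_vec ` E' \<subseteq> edge_cone E \<and> sum edge_height E < sum edge_height E'"
proof -
  let ?e = "(i, j, Neg)" and ?f = "(j, j, Pos)" and ?g = "(i, j, Pos)" and ?l = "(i, i, Pos)"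
  have ij: "i < j"
    using admissible_valid[OF E e] by auto
  have loop: "r = j" if "(r, r, s) \<in> E" for r s
    using tree f that unfolding one_loop_tree_def by blast
  \<comment> \<open>By (iii) and \<open>no_right\<close>, a positive nonloop edge starts before the
    loop vertex \<open>j\<close> and ends at or after it. By (i) and (v) against \<open>?e\<close>
    it does not start between \<open>i\<close> and \<open>j\<close>.\<close>
  have pos: "k < j" "j \<le> l" "k \<le> i" if kl: "(k, l, Pos) \<in> E" "k < l" for k l
  proof -
    show jl: "j \<le> l"
      using admissible_loop_pos[OF E f kl] by simp
    show kj: "k < j"
      using admissible_loop_pos[OF E f kl] no_right[of l] kl by (cases "k = j") auto
    show "k \<le> i"
    proof (rule ccontr)
      assume "\<not> k \<le> i"
      then have "i < k"
        by simp
      then show False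
        using admissible_pos_neg[OF E kl(1) e] admissible_noncrossing[OF E e kl(1)] kl kj jl
        by (cases "l = j") (auto simp: less_imp_le le_less)
    qed
  qed
  have "\<not> (k \<le> i \<and> j < l)" if "(k, l, Neg) \<in> E" for k l
    using admissible_loop_neg[OF E f that] ij by (meson less_imp_le less_trans le_less_trans less_le_trans)
  then have neg: "k = i" if "(k, l, Neg) \<in> E" "k \<le> i" "j \<le> l" for k l
    using i_min[of k] that by (metis antisym le_less)
  \<comment> \<open>\<open>?e\<close> has to leave before \<open>?g\<close> enters, since the two
    together violate (v).\<close>
  have adm_g: "admissible (insert ?g (E - {?e}))"
  proof (rule admissible_insert_Pos)
    show "admissible (E - {?e})"
      by (rule admissible_subset[OF E]) auto
    show "False" if "(k, l, t) \<in> E - {?e}" "i < k" "k < j" "j < l" for k l t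
      using admissible_noncrossing[OF E e, of k l t] that by auto
    show "False" if "(k, l, t) \<in> E - {?e}" "k < i" "i < l" "l < j" for k l t
      using admissible_noncrossing[OF E _ e, of k l t] that by auto
    show "i < l \<and> k < j" if "(k, l, Pos) \<in> E - {?e}" "k < l" for k l
      using pos[of k l] that ij by (fastforce intro: less_imp_le less_le_trans)
    show "i \<le> m \<and> m \<le> j" if "(m, m, Pos) \<in> E - {?e}" for m
      using loop[of m Pos] that ij by (fastforce intro: less_imp_le less_le_trans)
    show "False" if "(k, l, Neg) \<in> E - {?e}" "k \<le> i" "j \<le> l" for k l
    proof -
      have "k = i"
        using neg that by blast
      moreover have "l = j"
        using admissible_loop_neg[OF E f, of k l] that ij by (metis DiffD1 le_less le_less_trans)
      ultimately show False
        using that by simp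
    qed
  qed (rule ij)
  have neg_i: "False" if "(k, l, Neg) \<in> E" "k < i" "i < l" for k l
  proof -
    consider "l < j" | "l = j" | "j < l"
      by force
    then show False
    proof cases
      case 1
      then show False
        using admissible_noncrossing[OF E that(1) e] that by blast
    next
      case 2
      then show False
        using i_min that by force
    next
      case 3
      then show False
        using admissible_loop_neg[OF E f that(1)] that ij by (meson less_imp_le less_trans le_less_trans less_le_trans)
    qed
  qed
  have adm_l: "admissible (insert ?l E)"
  proof (rule admissible_insert_loop[OF E])
    show "k \<le> i \<and> i \<le> l" if "(k, l, Pos) \<in> E" "k < l" for k l
      using pos[OF that] ij by (meson less_imp_le less_trans le_less_trans less_le_trans)
  qed (rule neg_i)
  have adm_lg: "admissible (insert ?l (insert ?g (E - {?e})))"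
  proof (rule admissible_insert_loop[OF adm_g])
    show "k \<le> i \<and> i \<le> l" if "(k, l, Pos) \<in> insert ?g (E - {?e})" "k < l" for k l
      using pos[of k l] ij that by (fastforce intro: less_imp_le less_le_trans)
    show "False" if "(k, l, Neg) \<in> insert ?g (E - {?e})" "k < i" "i < l" for k l
      using neg_i that by auto
  qed
  have g: "edge_vec ?g = edge_vec ?e + edge_vec ?f" and l: "edge_vec ?l = edge_vec ?e + edge_vec ?g"
    by auto
  have gC: "edge_vec ?g \<in> edge_cone E"
    unfolding g by (intro edge_cone_add edge_cone_base e f)
  moreover have lC: "edge_vec ?l \<in> edge_cone E"
    unfolding l by (intro edge_cone_add edge_cone_base gC e)
  ultimately have sub: "edge_vec ` insert ?l (insert ?g E) \<subseteq> edge_cone E"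
    using edge_cone_base by blast
  have gE: "?g \<notin> E"
    using admissible_pos_neg[OF E _ e, of i j] ij by auto
  have lE: "?l \<notin> E"
    using loop[of i Pos] ij by auto
  have ne: "?e \<noteq> ?f" "?e \<noteq> ?g" "?f \<noteq> ?g" "?l \<noteq> ?e" "?l \<noteq> ?f" "?l \<noteq> ?g"
    using ij by auto
  have val: "\<forall>e\<in>E. valid_edge e"
    using admissible_valid[OF E] by blast
  have hpos: "0 < edge_height ?e" "0 < edge_height ?f"
    using edge_height_pos val e f by blast+
  have hg: "edge_height ?g = edge_height ?e + edge_height ?f"
    and hl: "edge_height ?l = edge_height ?e + edge_height ?g"
    using edge_height_add[OF g] edge_height_add[OF l] .
  let ?A = "insert ?g (E - {?e})" and ?B = "insert ?l (E - {?f})"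
  have tree_A: "one_loop_tree ?A"
  proof (rule one_loop_tree_exchange[OF tree e _ _ gE, of i j])
    show "(adj ?A)\<^sup>*\<^sup>* i j"
      by (intro r_into_rtranclp) (auto simp: adj_def)
  qed (use ij in auto)
  have tree_B: "one_loop_tree ?B"
    by (rule one_loop_tree_move_loop[OF tree f val])
  have tree_C: "one_loop_tree (insert ?l (?A - {?f}))"
  proof (rule one_loop_tree_move_loop[OF tree_A])
    show "\<forall>e\<in>?A. valid_edge e"
      using admissible_valid[OF adm_g] by blast
  qed (use f ne in auto)
  have hA: "sum edge_height E < sum edge_height ?A"
    using sum_height_exchange[OF e gE] hg hpos by simp
  have hB: "sum edge_height E < sum edge_height ?B"
    using sum_height_exchange[OF f lE] hl hg hpos by simp
  have "?f \<in> ?A" "?l \<notin> ?A"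
    using f ne lE by auto
  then have "sum edge_height (insert ?l (?A - {?f})) = sum edge_height ?A - edge_height ?f + edge_height ?l"
    by (rule sum_height_exchange)
  then have hC: "sum edge_height E < sum edge_height (insert ?l (?A - {?f}))"
    using hA hl hg hpos by simp
  \<comment> \<open>If \<open>?g\<close> replaced the loop, \<open>?l\<close> is exchanged against
    \<open>?e\<close> or \<open>?g\<close>. Dropping \<open>?g\<close> again gives
    \<open>?B\<close>, where the loop has simply moved from \<open>j\<close> to
    \<open>i\<close>.\<close>
  consider "x \<in> edge_cone ?A" | "x \<in> edge_cone ?B" | "x \<in> edge_cone (insert ?l (?A - {?f}))"
  proof -
    have "x \<in> edge_cone (insert ?l (?A - {?f})) \<or> x \<in> edge_cone ?B"
      if "x \<in> edge_cone (insert ?g (E - {?f}))"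
    proof -
      let ?D = "insert ?g (E - {?f})"
      have "x \<in> edge_cone (insert ?l (?D - {?e})) \<or> x \<in> edge_cone (insert ?l (?D - {?g}))"
        using that e ne lE by (intro edge_cone_exchange l) auto
      moreover have "insert ?l (?D - {?e}) = insert ?l (?A - {?f})"
        using ne by auto
      moreover have "insert ?l (?D - {?g}) = ?B"
        using gE by auto
      ultimately show ?thesis
        by simp
    qed
    then show thesis
      using edge_cone_exchange[OF x e f ne(1) gE g] that by blast
  qed
  then show ?thesis
  proof cases
    case 1
    then show ?thesis
      using tree_A adm_g sub hA by (intro exI[of _ ?A]) blast
  next
    case 2
    moreover have "admissible ?B"
      by (rule admissible_subset[OF adm_l]) auto
    ultimately show ?thesis
      using tree_B sub hB by (intro exI[of _ ?B]) blast
  next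
    case 3
    moreover have "admissible (insert ?l (?A - {?f}))"
      by (rule admissible_subset[OF adm_lg]) auto
    ultimately show ?thesis
      using tree_C sub hC by (intro exI[of _ "insert ?l (?A - {?f})"]) blast
  qed
qed

text \<open>An edge that crosses \<open>(i, b, Pos)\<close> crosses one of the two old edges unless
  it ends at \<open>j\<close>. At \<open>j\<close> the extremal choice of \<open>i\<close> and
  \<open>b\<close> excludes edges of the same kind, and (v) or (ii) the others.\<close>

lemma reduce_right:
  assumes tree: "one_loop_tree E" and E: "admissible E" and x: "x \<in> edge_cone E"
    and e: "(i, j, Neg) \<in> E" and f: "(j, b, Pos) \<in> E" "j < b"
    and i_min: "\<And>k. (k, j, Neg) \<in> E \<Longrightarrow> i \<le> k" and b_max: "\<And>c. (j, c, Pos) \<in> E \<Longrightarrow> c \<le> b"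
  shows "\<exists>E'. one_loop_tree E' \<and> admissible E' \<and> x \<in> edge_cone E' \<and>
    edge_vec ` E' \<subseteq> edge_cone E \<and> sum edge_height E < sum edge_height E'"
proof (rule reduce_triangle[OF tree _ x e f(1)])
  have ij: "i < j"
    using admissible_valid[OF E e] by auto
  show "admissible (insert (i, b, Pos) E)"
  proof (rule admissible_insert_Pos[OF E])
    show "i < b"
      using ij f by simp
    show "False" if kl: "(k, l, t) \<in> E" "i < k" "k < b" "b < l" for k l t
    proof -
      consider "k < j" | "k = j" | "j < k"
        by force
      then show False
      proof cases
        case 1
        then show False
          using admissible_noncrossing[OF E e kl(1)] kl f by (meson less_trans)
      next
        case 2
        then show False
          using b_max[of l] admissible_pos_neg[OF E f(1), of j l] kl f by (cases t) (auto simp: less_imp_le)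
      next
        case 3
        then show False
          using admissible_noncrossing[OF E f(1) kl(1)] kl by (meson less_imp_le less_trans le_less_trans less_le_trans)
      qed
    qed
    show "False" if kl: "(k, l, t) \<in> E" "k < i" "i < l" "l < b" for k l t
    proof -
      consider "l < j" | "l = j" | "j < l"
        by force
      then show False
      proof cases
        case 1
        then show False
          using admissible_noncrossing[OF E kl(1) e] kl by (meson less_imp_le less_trans le_less_trans less_le_trans)
      next
        case 2
        then show False
          using i_min[of k] admissible_pos_pos[OF E f(1), of k l] kl f less_trans[OF kl(2,3)] by (cases t) auto
      next
        case 3
        then show False
          using admissible_noncrossing[OF E kl(1) f(1)] kl ij by (meson less_imp_le less_trans le_less_trans less_le_trans)
      qed
    qed
    show "i < l \<and> k < b" if "(k, l, Pos) \<in> E" "k < l" for k l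
      using admissible_pos_pos[OF E f(1) that(1)] admissible_pos_pos[OF E that(1) f(1)] that f ij by (meson less_imp_le less_trans le_less_trans less_le_trans)
    show "i \<le> m \<and> m \<le> b" if "(m, m, Pos) \<in> E" for m
      using admissible_loop_pos[OF E that f] ij by (meson less_imp_le less_trans le_less_trans less_le_trans)
    show "False" if "(k, l, Neg) \<in> E" "k \<le> i" "b \<le> l" for k l
      using admissible_pos_neg[OF E f(1) that(1)] that f ij by (meson less_imp_le less_trans le_less_trans less_le_trans)
  qed
  show "edge_vec (i, b, Pos) = edge_vec (i, j, Neg) + edge_vec (j, b, Pos)"
    by simp
  show "joins (i, j, Neg) i j" "joins (j, b, Pos) j b" "joins (i, b, Pos) i b" "i \<noteq> j" "j \<noteq> b" "i \<noteq> b"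
    using ij f by auto
qed

text \<open>The new edge ends at \<open>i\<close>, so a loop at \<open>j\<close> would violate (iii)
  with it; hence \<open>no_loop\<close>. Crossing edges must again end at \<open>j\<close>, where
  the choice of \<open>i\<close> and \<open>p\<close> excludes them.\<close>

lemma reduce_left:
  assumes tree: "one_loop_tree E" and E: "admissible E" and x: "x \<in> edge_cone E"
    and e: "(i, j, Neg) \<in> E" and f: "(p, j, Pos) \<in> E" "p < j" and no_loop: "(j, j, Pos) \<notin> E"
    and i_min: "\<And>k. (k, j, Neg) \<in> E \<Longrightarrow> i \<le> k"
    and p_max: "\<And>q. (q, j, Pos) \<in> E \<Longrightarrow> q \<le> p"
  shows "\<exists>E'. one_loop_tree E' \<and> admissible E' \<and> x \<in> edge_cone E' \<and>
    edge_vec ` E' \<subseteq> edge_cone E \<and> sum edge_height E < sum edge_height E'"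
proof (rule reduce_triangle[OF tree _ x e f(1)])
  have ij: "i < j"
    using admissible_valid[OF E e] by auto
  \<comment> \<open>Otherwise the positive edge would lie under \<open>(i, j, Neg)\<close>, against
    (v).\<close>
  have pi: "p < i"
    using admissible_pos_neg[OF E f(1) e] f by force
  show "admissible (insert (p, i, Pos) E)"
  proof (rule admissible_insert_Pos[OF E pi])
    show "False" if kl: "(k, l, t) \<in> E" "p < k" "k < i" "i < l" for k l t
    proof -
      consider "l < j" | "l = j" | "j < l"
        by force
      then show False
      proof cases
        case 1
        then show False
          using admissible_noncrossing[OF E kl(1) e] kl by auto
      next
        case 2
        then show False
          using i_min[of k] p_max[of k] kl by (cases t) auto
      next
        case 3
        then show False
          using admissible_noncrossing[OF E f(1) kl(1)] kl ij by (meson less_trans)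
      qed
    qed
    show "False" if kl: "(k, l, t) \<in> E" "k < p" "p < l" "l < i" for k l t
      using admissible_noncrossing[OF E kl(1) f(1)] kl ij by (meson less_imp_le less_trans le_less_trans less_le_trans)
    show "p < l \<and> k < i" if kl: "(k, l, Pos) \<in> E" "k < l" for k l
    proof
      show "p < l"
        using admissible_pos_pos[OF E f(1) kl(1)] f kl by auto
      have kj: "k < j"
        using admissible_pos_pos[OF E kl(1) f(1)] f kl by auto
      show "k < i"
      proof (rule ccontr)
        assume "\<not> k < i"
        then have "i \<le> k"
          by simp
        then have "j < l"
          using admissible_pos_neg[OF E kl(1) e] kl by force
        then show False
          using admissible_noncrossing[OF E f(1) kl(1)] kj pi \<open>i \<le> k\<close> by (meson less_imp_le less_trans le_less_trans less_le_trans)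
      qed
    qed
    show "p \<le> m \<and> m \<le> i" if m: "(m, m, Pos) \<in> E" for m
    proof -
      have "m \<noteq> j"
        using m no_loop by auto
      then show ?thesis
        using admissible_loop_pos[OF E m f] admissible_loop_neg[OF E m e] by (metis le_less not_le)
    qed
    show "False" if kl: "(k, l, Neg) \<in> E" "k \<le> p" "i \<le> l" for k l
    proof -
      consider "j \<le> l" | "l < j" "i < l" | "l = i" "k < p" | "l = i" "k = p"
        using kl by force
      then show False
      proof cases
        case 1
        then show False
          using admissible_pos_neg[OF E f(1) kl(1)] kl f by auto
      next
        case 2
        then show False
          using admissible_noncrossing[OF E kl(1) e] kl pi by (meson less_imp_le less_trans le_less_trans less_le_trans)
      next
        case 3
        then show False
          using admissible_noncrossing[OF E kl(1) f(1)] pi ij by auto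
      next
        \<comment> \<open>\<open>(p, i, Neg)\<close> would close a triangle with the two old
          edges.\<close>
        case 4
        then show False
          using one_loop_tree_no_triangle[OF tree e f(1) kl(1), of j i p] pi ij f by auto
      qed
    qed
  qed
  show "edge_vec (p, i, Pos) = edge_vec (i, j, Neg) + edge_vec (p, j, Pos)"
    by simp
  show "joins (i, j, Neg) i j" "joins (p, j, Pos) j p" "joins (p, i, Pos) i p" "i \<noteq> j" "j \<noteq> p" "i \<noteq> p"
    using ij f pi by auto
qed

text \<open>Crossings again reduce to edges at \<open>j\<close>. A positive edge under the new one
  would have to span \<open>j\<close> by (v) and then, by (i), join \<open>i\<close> and
  \<open>k\<close>, closing a triangle. A loop under it could only sit at \<open>j\<close>, where
  \<open>no_Pos\<close> excludes it.\<close>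

lemma reduce_Neg:
  assumes tree: "one_loop_tree E" and E: "admissible E" and x: "x \<in> edge_cone E"
    and e: "(i, j, Neg) \<in> E" and f: "(j, k, Neg) \<in> E"
    and no_Pos: "\<And>l. (j, l, Pos) \<notin> E" "\<And>l. (l, j, Pos) \<notin> E"
    and i_min: "\<And>l. (l, j, Neg) \<in> E \<Longrightarrow> i \<le> l"
    and k_max: "\<And>l. (j, l, Neg) \<in> E \<Longrightarrow> l \<le> k"
  shows "\<exists>E'. one_loop_tree E' \<and> admissible E' \<and> x \<in> edge_cone E' \<and>
    edge_vec ` E' \<subseteq> edge_cone E \<and> sum edge_height E < sum edge_height E'"
proof (rule reduce_triangle[OF tree _ x e f])
  have ij: "i < j" and jk: "j < k"
    using admissible_valid[OF E e] admissible_valid[OF E f] by auto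
  show "admissible (insert (i, k, Neg) E)"
  proof (rule admissible_insert_Neg[OF E])
    show "i < k"
      using ij jk by simp
    show "False" if ab: "(a, b, t) \<in> E" "i < a" "a < k" "k < b" for a b t
    proof -
      consider "a < j" | "a = j" | "j < a"
        by force
      then show False
      proof cases
        case 1
        then show False
          using admissible_noncrossing[OF E e ab(1)] ab jk by (meson less_trans)
      next
        case 2
        then show False
          using no_Pos k_max[of b] ab by (cases t) auto
      next
        case 3
        then show False
          using admissible_noncrossing[OF E f ab(1)] ab by auto
      qed
    qed
    show "False" if ab: "(a, b, t) \<in> E" "a < i" "i < b" "b < k" for a b t
    proof -
      consider "b < j" | "b = j" | "j < b"
        by force
      then show False
      proof cases
        case 1
        then show False
          using admissible_noncrossing[OF E ab(1) e] ab by auto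
      next
        case 2
        then show False
          using no_Pos i_min[of a] ab by (cases t) auto
      next
        case 3
        then show False
          using admissible_noncrossing[OF E ab(1) f] ab ij by (meson less_imp_le less_trans le_less_trans less_le_trans)
      qed
    qed
    show "False" if m: "(m, m, Pos) \<in> E" "i < m" "m < k" for m
    proof -
      have "m \<noteq> j"
        using m no_Pos by auto
      then show False
        using admissible_loop_neg[OF E m(1) e] admissible_loop_neg[OF E m(1) f] m by (metis neqE)
    qed
    show "False" if ab: "(a, b, Pos) \<in> E" "i \<le> a" "a < b" "b \<le> k" for a b
    proof -
      have "a < j" "j < b"
        using admissible_pos_neg[OF E ab(1) e] admissible_pos_neg[OF E ab(1) f] ab by force+
      then have "a = i" "b = k"
        using admissible_noncrossing[OF E e ab(1)] admissible_noncrossing[OF E ab(1) f] ab by force+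
      then show False
        using one_loop_tree_no_triangle[OF tree e ab(1) f, of i j k] ij jk by auto
    qed
  qed
  show "edge_vec (i, k, Neg) = edge_vec (i, j, Neg) + edge_vec (j, k, Neg)"
    by simp
  show "joins (i, j, Neg) i j" "joins (j, k, Neg) j k" "joins (i, k, Neg) i k" "i \<noteq> j" "j \<noteq> k" "i \<noteq> k"
    using ij jk by auto
qed

text \<open>The order of the cases matters: a positive edge to the right, then the loop, then a
  positive edge to the left, then a negative edge. The loop case relies on having no positive edge
  to the right, the left case on having no loop at \<open>j\<close>, and the negative case on having
  no positive edge at \<open>j\<close>.\<close>

lemma reduce:
  fixes E :: "'n::{finite, linorder} sedge set"
  assumes tree: "one_loop_tree E" and E: "admissible E" and x: "x \<in> edge_cone E"
    and nonalt: "\<not> alternating_edges E"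
  shows "\<exists>E'. one_loop_tree E' \<and> admissible E' \<and> x \<in> edge_cone E' \<and>
    edge_vec ` E' \<subseteq> edge_cone E \<and> sum edge_height E < sum edge_height E'"
proof -
  obtain j e f where ef: "e \<in> E" "f \<in> E" "incident e j" "incident f j"
      "incident_sign e j = Neg" "incident_sign f j \<noteq> Neg"
  proof -
    obtain j e f where ef: "e \<in> E" "f \<in> E" "incident e j" "incident f j" 
        "incident_sign e j \<noteq> incident_sign f j"
      using nonalt unfolding alternating_edges_def by blast
    show thesis
    proof (cases "incident_sign e j = Neg")
      case True
      then show thesis
        using that[of e f j] ef by simp
    next
      case False
      then show thesis
        using that[of f e j] ef by (metis sign.exhaust)
    qed
  qed
  define I where "I = {i. (i, j, Neg) \<in> E}"
  have "I \<noteq> {}"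
    using ef unfolding I_def by (cases e) (auto split: if_splits)
  define i where "i = Min I"
  have i: "(i, j, Neg) \<in> E" and i_min: "\<And>k. (k, j, Neg) \<in> E \<Longrightarrow> i \<le> k"
    using Min_in[of I] \<open>I \<noteq> {}\<close> unfolding i_def I_def by auto
  consider (right) b where "(j, b, Pos) \<in> E" "j < b"
    | (loop) "(j, j, Pos) \<in> E" "\<And>b. (j, b, Pos) \<in> E \<Longrightarrow> b \<le> j"
    | (left) p where "(p, j, Pos) \<in> E" "p < j" "(j, j, Pos) \<notin> E"
    | (Neg) k where "(j, k, Neg) \<in> E" "\<And>l. (j, l, Pos) \<notin> E" "\<And>l. (l, j, Pos) \<notin> E"
  proof (cases "\<exists>b>j. (j, b, Pos) \<in> E")
    case True
    then show thesis
      using right by blast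
  next
    case no_right: False
    show thesis
    proof (cases "(j, j, Pos) \<in> E")
      case True
      then show thesis
        using loop no_right by (meson not_le)
    next
      case no_loop: False
      show thesis
      proof (cases "\<exists>p<j. (p, j, Pos) \<in> E")
        case True
        then show thesis
          using left no_loop by blast
      next
        case no_left: False
        have no_Pos: "(j, l, Pos) \<notin> E" "(l, j, Pos) \<notin> E" for l
          using no_right no_loop no_left admissible_valid[OF E, of "(j, l, Pos)"]
            admissible_valid[OF E, of "(l, j, Pos)"] by (auto simp: le_less)
        obtain a b s where f: "f = (a, b, s)"
          by (cases f)
        have "s = Neg"
          using ef f no_Pos by (cases s) auto
        then have "a = j"
          using ef f by (auto split: if_splits)
        then show thesis
          using Neg[of b] ef f \<open>s = Neg\<close> no_Pos by blast
      qed
    qed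
  qed
  then show ?thesis
  proof cases
    case right
    define B where "B = {c. (j, c, Pos) \<in> E}"
    have B: "finite B" "b \<in> B"
      using right unfolding B_def by auto
    have "(j, Max B, Pos) \<in> E"
      using Max_in[of B] B unfolding B_def by blast
    moreover have "j < Max B"
      using Max_ge[OF B] right by simp
    moreover have "c \<le> Max B" if "(j, c, Pos) \<in> E" for c
      using that B unfolding B_def by (intro Max_ge) auto
    ultimately show ?thesis
      using reduce_right[OF tree E x i _ _ i_min] by blast
  next
    case loop
    then show ?thesis
      using reduce_loop[OF tree E x i _ i_min] by blast
  next
    case left
    define B where "B = {q. (q, j, Pos) \<in> E}"
    have B: "finite B" "p \<in> B"
      using left unfolding B_def by auto
    have max: "(Max B, j, Pos) \<in> E"
      using Max_in[of B] B unfolding B_def by blast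
    moreover have "Max B \<noteq> j"
      using max left by auto
    then have "Max B < j"
      using admissible_valid[OF E max] by simp
    moreover have "c \<le> Max B" if "(c, j, Pos) \<in> E" for c
      using that B unfolding B_def by (intro Max_ge) auto
    ultimately show ?thesis
      using reduce_left[OF tree E x i _ _ left(3) i_min] by blast
  next
    case Neg
    define B where "B = {c. (j, c, Neg) \<in> E}"
    have B: "finite B" "k \<in> B"
      using Neg unfolding B_def by auto
    have "(j, Max B, Neg) \<in> E"
      using Max_in[of B] B unfolding B_def by blast
    moreover have "c \<le> Max B" if "(j, c, Neg) \<in> E" for c
      using that B unfolding B_def by (intro Max_ge) auto
    ultimately show ?thesis
      using reduce_Neg[OF tree E x i _ Neg(2,3) i_min] by blast
  qed
qed

text \<open>Among the finitely many candidate edge sets, one of maximal total height admits no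
  reduction.\<close>

lemma alternating_cover:
  fixes E :: "'n::{finite, linorder} sedge set"
  assumes tree: "one_loop_tree E" and E: "admissible E" and x: "x \<in> edge_cone E"
  obtains E' where "one_loop_tree E'" "admissible E'" "alternating_edges E'" "x \<in> edge_cone E'"
    "edge_vec ` E' \<subseteq> edge_cone E"
proof -
  define \<E> where "\<E> = {F. one_loop_tree F \<and> admissible F \<and> x \<in> edge_cone F \<and> edge_vec ` F \<subseteq> edge_cone E}"
  have "finite (UNIV :: 'n sedge set)"
    by (rule finite_sedges)
  then have fin: "finite \<E>"
    by (metis Finite_Set.finite_set finite_subset subset_UNIV)
  have "E \<in> \<E>"
    using assms unfolding \<E>_def by (auto intro: edge_cone_base)
  then obtain F where "is_arg_min (\<lambda>F. - sum edge_height F) (\<lambda>F. F \<in> \<E>) F"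
    using ex_is_arg_min_if_finite[OF fin] by blast
  then have F: "F \<in> \<E>" and F_max: "\<And>F'. F' \<in> \<E> \<Longrightarrow> sum edge_height F' \<le> sum edge_height F"
    by (force simp: is_arg_min_def)+
  have "alternating_edges F"
  proof (rule ccontr)
    assume "\<not> alternating_edges F"
    then obtain F' where F': "one_loop_tree F'" "admissible F'" "x \<in> edge_cone F'"
        "edge_vec ` F' \<subseteq> edge_cone F" "sum edge_height F < sum edge_height F'"
      using reduce[of F x] F unfolding \<E>_def by blast
    moreover have "edge_cone F \<subseteq> edge_cone E"
      using F unfolding \<E>_def by (intro edge_cone_mono) blast
    ultimately have "F' \<in> \<E>"
      unfolding \<E>_def by blast
    then show False
      using F_max F'(5) by fastforce
  qed
  then show thesis
    using that F unfolding \<E>_def by blast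
qed

section \<open>The triangulation\<close>

lemma pos_roots_eq: "(pos_roots :: (real ^ ('n::{finite, linorder})) set) = edge_vec ` {e. valid_edge e}"
proof (intro equalityI subsetI)
  fix x :: "real ^ ('n::_)" assume "x \<in> pos_roots"
  then consider i j where "i < j" "x = axis i 1 - axis j 1" | i j where "i < j" "x = axis i 1 + axis j 1"
    | k where "x = 2 *\<^sub>R axis k 1"
    unfolding pos_roots_def by blast
  then show "x \<in> edge_vec ` {e. valid_edge e}"
  proof cases
    case 1
    then show ?thesis by (intro image_eqI[of _ _ "(i, j, Neg)"]) auto
  next
    case 2
    then show ?thesis by (intro image_eqI[of _ _ "(i, j, Pos)"]) auto
  next
    case 3
    then show ?thesis by (intro image_eqI[of _ _ "(k, k, Pos)"]) (auto simp: scaleR_2)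
  qed
next
  fix x :: "real ^ ('n::_)" assume "x \<in> edge_vec ` {e. valid_edge e}"
  then obtain i j s where e: "valid_edge (i, j, s)" "x = edge_vec (i, j, s)"
    by auto
  show "x \<in> pos_roots"
  proof (cases s)
    case Neg
    then have "i < j"
      using e by auto
    then show ?thesis
      using e Neg unfolding pos_roots_def by auto
  next
    case Pos
    show ?thesis
    proof (cases "i = j")
      case True
      then have "x = 2 *\<^sub>R axis i 1"
        using e Pos by (simp add: scaleR_2)
      then show ?thesis
        unfolding pos_roots_def by blast
    next
      case False
      then have "i < j"
        using e by simp
      then show ?thesis
        using e Pos unfolding pos_roots_def by auto
    qed
  qed
qed

lemma graph_cone_eq: "graph_cone G = edge_cone (set_mset G)"
  by (simp add: graph_cone_def edge_cone_def)

lemma alternating_iff: "alternating G \<longleftrightarrow> alternating_edges (set_mset G)"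
  by (simp add: alternating_def alternating_edges_def)

lemma convex_edge_cone: "convex (edge_cone E)"
  by (intro convexI edge_cone_add edge_cone_scaleR)

lemma alt_ws_spanning_iff:
  fixes T :: "'n::{finite, linorder} sgraph"
  shows "H \<in> alt_ws_spanning T \<longleftrightarrow> H = mset_set (set_mset H) \<and> one_loop_tree (set_mset H) \<and>
    admissible (set_mset H) \<and> alternating_edges (set_mset H) \<and>
    edge_vec ` set_mset H \<subseteq> edge_cone (set_mset T)"
proof -
  have "spanning_graph H (graph_closure T) \<longleftrightarrow> edge_vec ` set_mset H \<subseteq> edge_cone (set_mset T)"
    if "admissible (set_mset H)"
  proof -
    have valid: "valid_edge e" if "e \<in># H" for e
      using admissible_valid[OF \<open>admissible (set_mset H)\<close> that] .
    then have "edge_vec e \<in> pos_roots" if "e \<in># H" for e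
      using that unfolding pos_roots_eq by blast
    then have "e \<in># graph_closure T \<longleftrightarrow> edge_vec e \<in> edge_cone (set_mset T)" if "e \<in># H" for e
      using that valid by (simp add: mem_graph_closure_iff graph_cone_eq)
    moreover have "signed_graph H"
      using valid by (simp add: signed_graph_def)
    ultimately show ?thesis
      unfolding spanning_graph_def by blast
  qed
  then show ?thesis
    unfolding alt_ws_spanning_def mem_Collect_eq well_structured_iff alternating_iff by blast
qed

lemma finite_alt_ws_spanning: "finite (alt_ws_spanning T)"
proof (rule finite_subset)
  show "alt_ws_spanning T \<subseteq> range mset_set"
    using alt_ws_spanning_iff by blast
  have "finite (UNIV :: 'a sedge set)"
    by (rule finite_sedges)
  then show "finite (range (mset_set :: 'a sedge set \<Rightarrow> _))"
    by (intro finite_imageI) (simp add: Finite_Set.finite_set)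
qed

text \<open>By \<open>root_in_alternating_cone\<close> the cone contains no further roots, so the
  polytope is spanned by 0 and the edge vectors alone.\<close>

lemma root_polytope_alternating:
  fixes H :: "'n::{finite, linorder} sgraph"
  assumes "one_loop_tree (set_mset H)" "admissible (set_mset H)" "alternating_edges (set_mset H)"
  shows "root_polytope H = convex hull (insert 0 (edge_vec ` set_mset H))"
proof -
  have valid: "\<forall>e\<in>set_mset H. valid_edge e"
    using admissible_valid[OF assms(2)] by blast
  have "pos_roots \<inter> edge_cone (set_mset H) = edge_vec ` set_mset H"
  proof (intro equalityI subsetI)
    fix x assume "x \<in> pos_roots \<inter> edge_cone (set_mset H)"
    then obtain e where e: "valid_edge e" "x = edge_vec e" "edge_vec e \<in> edge_cone (set_mset H)"
      unfolding pos_roots_eq by blast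
    obtain c where "\<And>f. 0 \<le> c f" "edge_vec e = (\<Sum>f\<in>set_mset H. c f *\<^sub>R edge_vec f)"
      by (rule edge_coneE[OF e(3)]) (rule that)
    then have "e \<in> set_mset H"
      by (rule root_in_alternating_cone[OF assms(1) valid assms(3) _ e(1)])
    then show "x \<in> edge_vec ` set_mset H"
      using e(2) by blast
  next
    fix x assume "x \<in> edge_vec ` set_mset H"
    then show "x \<in> pos_roots \<inter> edge_cone (set_mset H)"
      using valid edge_cone_base unfolding pos_roots_eq by blast
  qed
  then show ?thesis
    by (simp add: root_polytope_def graph_cone_eq)
qed

lemma affine_independent_one_loop_tree:
  fixes E :: "'n::{finite, linorder} sedge set"
  assumes "one_loop_tree E" "\<forall>e\<in>E. valid_edge e"
  shows "\<not> affine_dependent (insert 0 (edge_vec ` E))" "card (insert 0 (edge_vec ` E)) = CARD('n) + 1"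
    "0 \<notin> edge_vec ` E"
proof -
  have ind: "independent (edge_vec ` E)"
    by (rule independent_one_loop_tree[OF assms])
  show z: "0 \<notin> edge_vec ` E"
    using ind by (rule contrapos_nn) (rule dependent_zero)
  show "\<not> affine_dependent (insert 0 (edge_vec ` E))"
    using ind affine_dependent_iff_dependent[OF z] by simp
  show "card (insert 0 (edge_vec ` E)) = CARD('n) + 1"
    using z inj_on_one_loop_tree[OF assms] card_one_loop_tree[OF assms]
    by (simp add: finite_sedges card_image)
qed

text \<open>Relative interior points of a simplex have strictly positive barycentric coordinates.
  The support of \<open>c\<close> is therefore all of \<open>E\<close>, and the graph can be
  recovered from \<open>c\<close>.\<close>

lemma rel_interior_one_loop_tree:
  fixes E :: "'n::{finite, linorder} sedge set"
  assumes tree: "one_loop_tree E" and adm: "admissible E" and alt: "alternating_edges E"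
    and x: "x \<in> rel_interior (convex hull (insert 0 (edge_vec ` E)))"
  obtains c where "canonical c" "combination c = x" "{e. 0 < c e} = E"
proof -
  have valid: "\<forall>e\<in>E. valid_edge e"
    using admissible_valid[OF adm] by blast
  note ind = affine_independent_one_loop_tree[OF tree valid]
  obtain u where u: "\<And>y. y \<in> insert 0 (edge_vec ` E) \<Longrightarrow> 0 < u y"
      "(\<Sum>y\<in>insert 0 (edge_vec ` E). u y *\<^sub>R y) = x"
    using x unfolding rel_interior_convex_hull_explicit[OF ind(1)] by blast
  define c where "c e = (if e \<in> E then u (edge_vec e) else 0)" for e
  have supp: "{e. 0 < c e} = E"
    using u(1) by (auto simp: c_def)
  have "x = (\<Sum>y\<in>edge_vec ` E. u y *\<^sub>R y)"
    using u(2) ind(3) by (simp add: finite_sedges)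
  also have "\<dots> = (\<Sum>e\<in>E. u (edge_vec e) *\<^sub>R edge_vec e)"
    using inj_on_one_loop_tree[OF tree valid] by (simp add: sum.reindex)
  also have "\<dots> = combination c"
    unfolding combination_def by (rule sum.mono_neutral_cong_left) (auto simp: c_def finite_sedges)
  finally have "combination c = x" ..
  moreover have "i = j" if "(i, i, Pos) \<in> E" "(j, j, Pos) \<in> E" for i j
    using tree that unfolding one_loop_tree_def by blast
  then have "canonical c"
    using adm alt supp u(1) unfolding canonical_def by (auto simp: c_def less_imp_le)
  ultimately show thesis
    using that supp by blast
qed

text \<open>The missing weight \<open>1 - sum c E\<close> goes to the vertex 0.\<close>

lemma convex_hull_insert_0I:
  assumes "finite E" "\<And>e. e \<in> E \<Longrightarrow> 0 \<le> c e" "sum c E \<le> 1"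
  shows "(\<Sum>e\<in>E. c e *\<^sub>R v e) \<in> convex hull (insert 0 (v ` E))"
proof (cases "sum c E = 0")
  case True
  then have "c e = 0" if "e \<in> E" for e
    using that assms(1,2) by (simp add: sum_nonneg_eq_0_iff)
  then show ?thesis
    by (simp add: hull_inc)
next
  case False
  define s where "s = sum c E"
  have s: "0 < s" "s \<le> 1"
    using False assms(3) sum_nonneg[of E c] assms(2) unfolding s_def by force+
  have "(\<Sum>e\<in>E. (c e / s) *\<^sub>R v e) \<in> convex hull (insert 0 (v ` E))"
  proof (rule convex_sum)
    show "(\<Sum>e\<in>E. c e / s) = 1"
      using s by (simp add: s_def flip: sum_divide_distrib)
  qed (use assms s in \<open>auto intro: hull_inc\<close>)
  then have "(1 - s) *\<^sub>R 0 + s *\<^sub>R (\<Sum>e\<in>E. (c e / s) *\<^sub>R v e) \<in> convex hull (insert 0 (v ` E))"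
    using s by (intro convexD_alt) (auto intro: hull_inc)
  then show ?thesis
    using s by (simp add: scaleR_sum_right)
qed

lemma root_polytope_cover:
  fixes T :: "'n::{finite, linorder} sgraph"
  assumes T: "well_structured T" and x: "x \<in> root_polytope T"
  shows "\<exists>H\<in>alt_ws_spanning T. x \<in> root_polytope H"
proof -
  let ?T = "set_mset T"
  have T': "one_loop_tree ?T" "admissible ?T"
    using T by (auto simp: well_structured_iff)
  have "root_polytope T \<subseteq> edge_cone ?T"
    unfolding root_polytope_def graph_cone_eq
    by (rule hull_minimal) (auto simp: edge_cone_0 convex_edge_cone)
  then have "x \<in> edge_cone ?T"
    using x by blast
  then obtain E where E: "one_loop_tree E" "admissible E" "alternating_edges E" "x \<in> edge_cone E"
      "edge_vec ` E \<subseteq> edge_cone ?T"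
    by (rule alternating_cover[OF T']) (rule that)
  define H where "H = mset_set E"
  have EH: "set_mset H = E"
    by (simp add: H_def finite_sedges)
  have "H \<in> alt_ws_spanning T"
    using E unfolding alt_ws_spanning_iff EH by (simp add: H_def)
  moreover have "x \<in> root_polytope H"
  proof -
    obtain c where c: "\<And>e. 0 \<le> c e" "x = (\<Sum>e\<in>E. c e *\<^sub>R edge_vec e)"
      by (rule edge_coneE[OF E(4)]) (rule that)
    have valid: "\<forall>e\<in>E. valid_edge e"
      using admissible_valid[OF E(2)] by blast
    obtain \<sigma> :: "real ^ ('n::_)" where \<sigma>: "\<And>u. \<bar>\<sigma> $ u\<bar> = 1"
        "\<And>e u. e \<in> E \<Longrightarrow> \<sigma> $ u * edge_vec e $ u = \<bar>edge_vec e $ u\<bar>"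
      by (rule alternating_edges_sign[OF E(3) valid]) (rule that)
    \<comment> \<open>The sign vector of \<open>E\<close> is at most 2 on every root, hence on the
      polytope of \<open>T\<close>, and equal to 2 on the edges of \<open>E\<close>. So the
      coefficients of \<open>x\<close> sum to at most 1.\<close>
    have "root_polytope T \<subseteq> {y. \<sigma> \<bullet> y \<le> 2}"
      unfolding root_polytope_def pos_roots_eq
      by (rule hull_minimal) (auto intro: inner_edge_vec_le[OF \<sigma>(1)] simp: convex_halfspace_le)
    then have "\<sigma> \<bullet> x \<le> 2"
      using x by blast
    moreover have "\<sigma> \<bullet> edge_vec e = 2" if "e \<in> E" for e
      using sum_abs_edge_vec[of e] valid that \<sigma>(2)[OF that] by (simp add: inner_vec_def)
    then have "\<sigma> \<bullet> x = (\<Sum>e\<in>E. c e * 2)"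
      unfolding c(2) by (simp add: inner_sum_right)
    ultimately have "sum c E \<le> 1"
      by (simp flip: sum_distrib_right)
    then show ?thesis
      unfolding c(2) using root_polytope_alternating[of H] E c(1)
      by (simp add: EH convex_hull_insert_0I finite_sedges)
  qed
  ultimately show ?thesis
    by blast
qed

theorem theorem28:
  fixes T :: "'n::{finite, linorder} sgraph"
  assumes "well_structured T"
  shows "(\<forall>H \<in> alt_ws_spanning T. int CARD('n) simplex root_polytope H) \<and>
         central_triangulation T (alt_ws_spanning T) root_polytope \<and>
         measure lebesgue (root_polytope T) =
           real (card (alt_ws_spanning T)) * (2 / fact CARD('n))"
proof -
  let ?A = "alt_ws_spanning T"
  have A: "H = mset_set (set_mset H)" "one_loop_tree (set_mset H)" "admissible (set_mset H)"
      "alternating_edges (set_mset H)" "\<forall>e\<in>set_mset H. valid_edge e"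
      "edge_vec ` set_mset H \<subseteq> edge_cone (set_mset T)" if "H \<in> ?A" for H
    using that admissible_valid unfolding alt_ws_spanning_iff by blast+
  have P: "root_polytope H = convex hull (insert 0 (edge_vec ` set_mset H))" if "H \<in> ?A" for H
    using A[OF that] by (intro root_polytope_alternating)
  have simplex: "int CARD('n) simplex root_polytope H" if "H \<in> ?A" for H
    unfolding P[OF that] simplex_def using affine_independent_one_loop_tree[OF A(2,5)[OF that]]
    by (intro exI[of _ "insert 0 (edge_vec ` set_mset H)"]) simp
  have cone: "graph_cone H \<subseteq> graph_cone T" if "H \<in> ?A" for H
    unfolding graph_cone_eq using A(6)[OF that] by (rule edge_cone_mono)
  have sub: "root_polytope H \<subseteq> root_polytope T" if "H \<in> ?A" for H
    unfolding root_polytope_def using cone[OF that] by (intro hull_mono) blast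
  have union: "(\<Union>H\<in>?A. root_polytope H) = root_polytope T"
    using sub root_polytope_cover[OF assms] by blast
  have dim: "aff_dim (root_polytope T) = int CARD('n)"
  proof -
    \<comment> \<open>Covering the origin shows that the family of simplices is nonempty.\<close>
    have "0 \<in> root_polytope T"
      unfolding root_polytope_def by (rule hull_inc) simp
    then obtain H where H: "H \<in> ?A"
      using union by blast
    then have "int CARD('n) \<le> aff_dim (root_polytope T)"
      using aff_dim_subset[OF sub[OF H]] aff_dim_simplex[OF simplex[OF H]] by simp
    moreover have "aff_dim (root_polytope T) \<le> int CARD('n)"
      using aff_dim_le_DIM[of "root_polytope T"] by simp
    ultimately show ?thesis
      by simp
  qed
  have disjoint: "rel_interior (root_polytope H) \<inter> rel_interior (root_polytope H') = {}"
    if H: "H \<in> ?A" "H' \<in> ?A" "H \<noteq> H'" for H H'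
  proof (rule ccontr)
    assume "\<not> ?thesis"
    then obtain x where x: "x \<in> rel_interior (root_polytope H)" "x \<in> rel_interior (root_polytope H')"
      by blast
    obtain c where c: "canonical c" "combination c = x" "{e. 0 < c e} = set_mset H"
      using x(1) unfolding P[OF H(1)]
      by (rule rel_interior_one_loop_tree[OF A(2-4)[OF H(1)]]) (rule that)
    obtain d where d: "canonical d" "combination d = x" "{e. 0 < d e} = set_mset H'"
      using x(2) unfolding P[OF H(2)]
      by (rule rel_interior_one_loop_tree[OF A(2-4)[OF H(2)]]) (rule that)
    have "c = d"
      using canonical_unique c d by blast
    then have "set_mset H = set_mset H'"
      using c(3) d(3) by simp
    then show False
      using H(3) A(1)[OF H(1)] A(1)[OF H(2)] by simp
  qed
  have triangulation: "central_triangulation T ?A root_polytope"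
    unfolding central_triangulation_def
  proof (intro conjI ballI allI impI)
    fix H assume H: "H \<in> ?A"
    show "aff_dim (root_polytope T) simplex root_polytope H"
      unfolding dim by (rule simplex[OF H])
    show "0 extreme_point_of root_polytope H"
      unfolding P[OF H] using affine_independent_one_loop_tree(1)[OF A(2,5)[OF H]]
      by (simp add: extreme_point_of_convex_hull_affine_independent)
    fix x assume "x extreme_point_of root_polytope H \<and> x \<noteq> 0"
    then show "x \<in> pos_roots \<inter> graph_cone T"
      using cone[OF H] extreme_point_of_convex_hull unfolding root_polytope_def by blast
  next
    show "disjoint_family_on (\<lambda>H. rel_interior (root_polytope H)) ?A"
      unfolding disjoint_family_on_def using disjoint by blast
  qed (rule union)
  have compact: "compact (root_polytope H)" and convex: "convex (root_polytope H)" if "H \<in> ?A" for H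
    unfolding P[OF that] by (auto intro!: finite_imp_compact_convex_hull simp: finite_sedges)
  have "measure lebesgue (\<Union> (root_polytope ` ?A)) = (\<Sum>H\<in>?A. measure lebesgue (root_polytope H))"
  proof (rule measure_negligible_finite_Union_image)
    show "finite ?A"
      by (rule finite_alt_ws_spanning)
    show "root_polytope H \<in> lmeasurable" if "H \<in> ?A" for H
      using compact[OF that] by (rule lmeasurable_compact)
    show "pairwise (\<lambda>H H'. negligible (root_polytope H \<inter> root_polytope H')) ?A"
    proof (rule pairwiseI)
      fix H H' assume H: "H \<in> ?A" "H' \<in> ?A" "H \<noteq> H'"
      \<comment> \<open>The intersection is convex, so an empty interior makes it a null
        set.\<close>
      have "interior (root_polytope H \<inter> root_polytope H') = {}"
        using disjoint[OF H] interior_subset_rel_interior by fastforce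
      then show "negligible (root_polytope H \<inter> root_polytope H')"
        using convex H by (subst negligible_convex_interior) (auto intro: convex_Int)
    qed
  qed
  also have "\<dots> = (\<Sum>H\<in>?A. 2 / fact CARD('n))"
  proof (rule sum.cong[OF refl])
    fix H assume H: "H \<in> ?A"
    show "measure lebesgue (root_polytope H) = 2 / fact CARD('n)"
      unfolding P[OF H] by (rule measure_one_loop_tree[OF A(2,5)[OF H]])
  qed
  finally have "measure lebesgue (root_polytope T) = real (card ?A) * (2 / fact CARD('n))"
    unfolding union by simp
  then show ?thesis
    using simplex triangulation by blast
qed

end
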